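(* **[A.] ($H$-orbits)** The set of $H$-orbits on elements of $\mathrm{Hyp}_V\times\mathrm{Hyp}_W$ is in bijection with the set of quintuples $(s,r,d,m,n)\in\mathbb Z^2\times\mathbb Z_{\ge0}^3/\sim$, where the equivalence relation $\sim$ is given by - $(s,r,d,m,n)\sim(s,r,d,0,n)$ for $d\ge0$, $m\le n$; - $(s,r,d,m,n)\sim(s,r,d,m,0)$ for $d\ge0$, $m\ge n+d$. A representative with invariants $(s,r,d,m,n)$ is the pair of lattices determined by the column vectors of the matrices $$\varpi^s\begin{pmatrix}1&0&\varpi^{-m}\\0&1&\varpi^{-n}\\0&0&1\end{pmatrix}\qquad\text{and}\qquad\varpi^r\begin{pmatrix}\varpi^d&0\\0&1\end{pmatrix}.$$ **[B.] ($H_0$-orbits)** The $H_0$-orbits contained in a given $H$-orbit corresponding to a quintuple $(s,r,d,m,n)$ are indexed by a parameter $k\in\mathbb Z$. A representative of invariant $(k,s,r,d,m,n)$ is explicitly given by the column vectors of the matrices $$\varpi^s\begin{pmatrix}\varpi^k&0&\varpi^{k-m}\\0&1&\varpi^{-n}\\0&0&1\end{pmatrix}\qquad\text{and}\qquad\begin{pmatrix}\varpi^{k+d+r}&0\\0&\varpi^{r}\end{pmatrix}.$$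
   Context: $k_0$ is the completion of a totally real number field at a finite place, with ring of integers $\mathcal O$, uniformizer $\varpi$ and normalized valuation $v$. $V$ is a $3$-dimensional $k_0$-vector space, $W\subset V$ a $2$-dimensional subspace, $D\subset V$ a line not contained in $W$. $L_W\subset W$ and $L_D\subset D$ are fixed lattices with $\mathcal O$-bases $\{e_1,e_2\}$ and $\{e_3\}$; column vectors are taken with respect to $e_1,e_2,e_3$ in $V$ and $e_1,e_2$ in $W$. $\mathrm{Hyp}_V$ (resp. $\mathrm{Hyp}_W$) is the set of $\mathcal O$-lattices in $V$ (resp. $W$). $H=\mathrm{GL}(W)\cong\mathrm{GL}_2(k_0)$ acts on $\mathrm{Hyp}_V\times\mathrm{Hyp}_W$ diagonally, acting on $V=W\oplus D$ through $h\mapsto h\oplus\mathrm{id}_D$, and $H_0=\{h\in H:v(\det h)=0\}$.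
   Formalization: The conditions defining ∼ are corrected: m may be replaced by 0 when m+d≤n (not m≤n), and n by 0 when m≥n (not m≥n+d). As printed, d=1 identifies (m,n)=(1,1) with (0,1), whose representatives lie in different H-orbits. *)

theory Defs
  imports "HOL-Analysis.Analysis"
begin

(* Valuations are integer-valued functions; their value at 0 is irrelevant everywhere below. *)

definition normalized_valuation :: "('k::field \<Rightarrow> int) \<Rightarrow> bool" where
  "normalized_valuation v \<longleftrightarrow>
     (\<forall>x y. x \<noteq> 0 \<longrightarrow> y \<noteq> 0 \<longrightarrow> v (x * y) = v x + v y) \<and>
     (\<forall>x y. x \<noteq> 0 \<longrightarrow> y \<noteq> 0 \<longrightarrow> x + y \<noteq> 0 \<longrightarrow> min (v x) (v y) \<le> v (x + y)) \<and>
     (\<exists>x. x \<noteq> 0 \<and> v x = 1)"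

definition val_ring :: "('k::field \<Rightarrow> int) \<Rightarrow> 'k set" where
  "val_ring v = {x. x = 0 \<or> 0 \<le> v x}"

definition uniformizer :: "('k::field \<Rightarrow> int) \<Rightarrow> 'k \<Rightarrow> bool" where
  "uniformizer v \<pi> \<longleftrightarrow> \<pi> \<noteq> 0 \<and> v \<pi> = 1"

definition val_close :: "('k::field \<Rightarrow> int) \<Rightarrow> int \<Rightarrow> 'k \<Rightarrow> 'k \<Rightarrow> bool" where
  "val_close v N x y \<longleftrightarrow> x = y \<or> N \<le> v (x - y)"

definition val_complete :: "('k::field \<Rightarrow> int) \<Rightarrow> bool" where
  "val_complete v \<longleftrightarrow>
     (\<forall>X :: nat \<Rightarrow> 'k. (\<forall>N. \<exists>M. \<forall>i\<ge>M. \<forall>j\<ge>M. val_close v N (X i) (X j)) \<longrightarrow>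
        (\<exists>l. \<forall>N. \<exists>M. \<forall>i\<ge>M. val_close v N (X i) l))"

definition val_dense :: "('k::field \<Rightarrow> int) \<Rightarrow> 'k set \<Rightarrow> bool" where
  "val_dense v F \<longleftrightarrow> (\<forall>x N. \<exists>y\<in>F. val_close v N x y)"

definition is_subfield :: "'k::field set \<Rightarrow> bool" where
  "is_subfield F \<longleftrightarrow> 1 \<in> F \<and> (\<forall>x\<in>F. \<forall>y\<in>F. x - y \<in> F \<and> x * y \<in> F) \<and> (\<forall>x\<in>F. inverse x \<in> F)"

definition is_number_field :: "'k::field_char_0 set \<Rightarrow> bool" where
  "is_number_field F \<longleftrightarrow> is_subfield F \<and>
     (\<exists>B. finite B \<and> F = {(\<Sum>b\<in>B. of_rat (c b) * b) | c. True})"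

definition field_embedding :: "'k::field set \<Rightarrow> ('k \<Rightarrow> complex) \<Rightarrow> bool" where
  "field_embedding F \<sigma> \<longleftrightarrow> \<sigma> 1 = 1 \<and>
     (\<forall>x\<in>F. \<forall>y\<in>F. \<sigma> (x + y) = \<sigma> x + \<sigma> y \<and> \<sigma> (x * y) = \<sigma> x * \<sigma> y)"

definition totally_real_number_field :: "'k::field_char_0 set \<Rightarrow> bool" where
  "totally_real_number_field F \<longleftrightarrow>
     is_number_field F \<and> (\<forall>\<sigma>. field_embedding F \<sigma> \<longrightarrow> \<sigma> ` F \<subseteq> \<real>)"

(* The whole type 'k is the completion of its subfield F at the finite place v restricted to F,
   and v is the normalized valuation of the completion. *)
definition completion_at_finite_place :: "('k::field_char_0 \<Rightarrow> int) \<Rightarrow> 'k set \<Rightarrow> bool" where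
  "completion_at_finite_place v F \<longleftrightarrow>
     normalized_valuation v \<and> val_complete v \<and> val_dense v F"

(* Only meant for finite B: sums over infinite sets are 0. *)
definition O_span ::
  "('k::field \<Rightarrow> 'v::ab_group_add \<Rightarrow> 'v) \<Rightarrow> ('k \<Rightarrow> int) \<Rightarrow> 'v set \<Rightarrow> 'v set" where
  "O_span smul v B = {(\<Sum>b\<in>B. smul (c b) b) | c. c ` B \<subseteq> val_ring v}"

definition lattices ::
  "('k::field \<Rightarrow> 'v::ab_group_add \<Rightarrow> 'v) \<Rightarrow> ('k \<Rightarrow> int) \<Rightarrow> 'v set \<Rightarrow> 'v set set" where
  "lattices smul v U = {L. \<exists>B. finite B \<and> L = O_span smul v B \<and> module.span smul B = U}"

definition O_basis ::
  "('k::field \<Rightarrow> 'v::ab_group_add \<Rightarrow> 'v) \<Rightarrow> ('k \<Rightarrow> int) \<Rightarrow> 'v set \<Rightarrow> 'v^'n::finite \<Rightarrow> bool" where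
  "O_basis smul v L e \<longleftrightarrow>
     L = O_span smul v (range (\<lambda>i. e $ i)) \<and>
     (\<forall>c. (\<forall>i. c i \<in> val_ring v) \<longrightarrow> (\<Sum>i\<in>UNIV. smul (c i) (e $ i)) = 0 \<longrightarrow> (\<forall>i. c i = 0))"

definition of_coords ::
  "('k::field \<Rightarrow> 'v::ab_group_add \<Rightarrow> 'v) \<Rightarrow> 'v^'n::finite \<Rightarrow> 'k^'n \<Rightarrow> 'v" where
  "of_coords smul e x = (\<Sum>i\<in>UNIV. smul (x $ i) (e $ i))"

definition column_lattice ::
  "('k::field \<Rightarrow> 'v::ab_group_add \<Rightarrow> 'v) \<Rightarrow> ('k \<Rightarrow> int) \<Rightarrow> 'v^'n::finite \<Rightarrow> 'k^'n^'n \<Rightarrow> 'v set" where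
  "column_lattice smul v e A = O_span smul v (of_coords smul e ` columns A)"

(* Automorphisms of the subspace W, normalized to be undefined off W. *)
definition GL_on ::
  "('k::field \<Rightarrow> 'v::ab_group_add \<Rightarrow> 'v) \<Rightarrow> 'v set \<Rightarrow> ('v \<Rightarrow> 'v) set" where
  "GL_on smul W = {h \<in> extensional W. bij_betw h W W \<and>
     (\<forall>x\<in>W. \<forall>y\<in>W. h (x + y) = h x + h y) \<and> (\<forall>c. \<forall>x\<in>W. h (smul c x) = smul c (h x))}"

definition matrix_wrt ::
  "('k::field \<Rightarrow> 'v::ab_group_add \<Rightarrow> 'v) \<Rightarrow> 'v^'n::finite \<Rightarrow> ('v \<Rightarrow> 'v) \<Rightarrow> 'k^'n^'n" where
  "matrix_wrt smul e h = (THE A. \<forall>j. h (e $ j) = of_coords smul e (column j A))"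

(* e is meant to be a k-basis of W; the determinant does not depend on its choice. *)
definition GL0_on ::
  "('k::field \<Rightarrow> 'v::ab_group_add \<Rightarrow> 'v) \<Rightarrow> ('k \<Rightarrow> int) \<Rightarrow> 'v set \<Rightarrow> 'v^'n::finite \<Rightarrow> ('v \<Rightarrow> 'v) set" where
  "GL0_on smul v W e = {h \<in> GL_on smul W. v (det (matrix_wrt smul e h)) = 0}"

(* h (+) id_D on V = W (+) D. *)
definition plus_id :: "'v::ab_group_add set \<Rightarrow> 'v set \<Rightarrow> ('v \<Rightarrow> 'v) \<Rightarrow> 'v \<Rightarrow> 'v" where
  "plus_id W D h x = (THE y. \<exists>w\<in>W. \<exists>d\<in>D. x = w + d \<and> y = h w + d)"

definition act ::
  "'v::ab_group_add set \<Rightarrow> 'v set \<Rightarrow> ('v \<Rightarrow> 'v) \<Rightarrow> 'v set \<times> 'v set \<Rightarrow> 'v set \<times> 'v set" where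
  "act W D h p = (plus_id W D h ` fst p, h ` snd p)"

definition orbits ::
  "'v::ab_group_add set \<Rightarrow> 'v set \<Rightarrow> ('v \<Rightarrow> 'v) set \<Rightarrow> ('v set \<times> 'v set) set
     \<Rightarrow> ('v set \<times> 'v set) set set" where
  "orbits W D G P = (\<lambda>p. (\<lambda>h. act W D h p) ` G) ` P"

type_synonym quintuple = "int \<times> int \<times> nat \<times> nat \<times> nat"

(* The shift by d has to sit in the rule that makes m vanish: the stabilizer of
   the lattice with basis p^d e1, e2 in GL_2(O) consists of the matrices whose upper right entry is
   divisible by p^d, so e2 can be added to e1-coordinates only after multiplication by p^d,
   while the lower left entry is unrestricted. *)
inductive quint_step :: "quintuple \<Rightarrow> quintuple \<Rightarrow> bool" where
  "m + d \<le> n \<Longrightarrow> quint_step (s, r, d, m, n) (s, r, d, 0, n)"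
| "n \<le> m \<Longrightarrow> quint_step (s, r, d, m, n) (s, r, d, m, 0)"

definition quint_rel :: "(quintuple \<times> quintuple) set" where
  "quint_rel = {(x, y). equivclp quint_step x y}"

definition matV :: "'k::field \<Rightarrow> quintuple \<Rightarrow> 'k^3^3" where
  "matV \<pi> = (\<lambda>(s, r, d, m, n). map_matrix ((*) (\<pi> powi s))
     (vector [vector [1, 0, \<pi> powi (- int m)],
              vector [0, 1, \<pi> powi (- int n)],
              vector [0, 0, 1]]))"

definition matW :: "'k::field \<Rightarrow> quintuple \<Rightarrow> 'k^2^2" where
  "matW \<pi> = (\<lambda>(s, r, d, m, n). map_matrix ((*) (\<pi> powi r))
     (vector [vector [\<pi> ^ d, 0],
              vector [0, 1]]))"

definition matV0 :: "'k::field \<Rightarrow> int \<Rightarrow> quintuple \<Rightarrow> 'k^3^3" where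
  "matV0 \<pi> k = (\<lambda>(s, r, d, m, n). map_matrix ((*) (\<pi> powi s))
     (vector [vector [\<pi> powi k, 0, \<pi> powi (k - int m)],
              vector [0, 1, \<pi> powi (- int n)],
              vector [0, 0, 1]]))"

definition matW0 :: "'k::field \<Rightarrow> int \<Rightarrow> quintuple \<Rightarrow> 'k^2^2" where
  "matW0 \<pi> k = (\<lambda>(s, r, d, m, n).
     vector [vector [\<pi> powi (k + int d + r), 0],
             vector [0, \<pi> powi r]])"

end

theory Submission
  imports Defs
begin

text \<open>
  In coordinates, \<open>H\<close> is \<open>GL\<^sub>2(k\<^sub>0)\<close>. A lattice in \<open>V\<close> consists of its intersection with \<open>W\<close> and a
  class \<open>w\<close> modulo this intersection, generating the lattice together with \<open>\<pi>\<^sup>s e\<^sub>3 + w\<close>. By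
  elementary divisors \<open>H\<close> moves the intersection to \<open>\<pi>\<^sup>s \<langle>e\<^sub>1, e\<^sub>2\<rangle>\<close> and the lattice in \<open>W\<close> to
  \<open>\<pi>\<^sup>r \<langle>\<pi>\<^sup>d e\<^sub>1, e\<^sub>2\<rangle>\<close>, after which diagonal units make \<open>w\<close> equal to \<open>\<pi>\<^sup>s (\<pi>\<^sup>-\<^sup>m, \<pi>\<^sup>-\<^sup>n)\<close>.
  The numbers \<open>s\<close>, \<open>r\<close>, \<open>d\<close>, the order of \<open>w\<close> modulo the intersection, which is \<open>max m n\<close>, and
  the least \<open>t \<ge> 0\<close> such that \<open>w\<close> lies in the sum of the intersection and \<open>\<pi>\<close> to the power \<open>s - r - t\<close>
  times the second lattice, which is \<open>max n (m + d)\<close> for \<open>m > 0\<close> and \<open>n\<close> for \<open>m = 0\<close>, are invariant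
  and determine the class of the quintuple. The \<open>H\<^sub>0\<close>-orbits in an \<open>H\<close>-orbit are separated by the
  valuation of the determinant, because the stabilizer of a lattice in \<open>W\<close> has unit determinants.
\<close>

subsection \<open>Fractional ideals of a discrete valuation\<close>

locale valued_field =
  fixes v :: "'k::field \<Rightarrow> int" and \<pi> :: 'k
  assumes normalized: "normalized_valuation v" and uniformizer: "uniformizer v \<pi>"
begin

lemma v_mult: "x \<noteq> 0 \<Longrightarrow> y \<noteq> 0 \<Longrightarrow> v (x * y) = v x + v y"
  using normalized unfolding normalized_valuation_def by blast

lemma v_add: "x \<noteq> 0 \<Longrightarrow> y \<noteq> 0 \<Longrightarrow> x + y \<noteq> 0 \<Longrightarrow> min (v x) (v y) \<le> v (x + y)"
  using normalized unfolding normalized_valuation_def by blast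

lemma pi_nz [simp]: "\<pi> \<noteq> 0" and v_pi [simp]: "v \<pi> = 1"
  using uniformizer unfolding uniformizer_def by auto

lemma v_one [simp]: "v 1 = 0"
  using v_mult[of 1 1] by simp

lemma v_minus [simp]: "v (- x) = v x"
proof (cases "x = 0")
  case False
  have "v (-1) = 0"
    using v_mult[of "-1" "-1"] by simp
  then show ?thesis
    using v_mult[of "-1" x] False by simp
qed simp

lemma v_inverse: "x \<noteq> 0 \<Longrightarrow> v (inverse x) = - v x"
  using v_mult[of x "inverse x"] by simp

lemma v_divide: "x \<noteq> 0 \<Longrightarrow> y \<noteq> 0 \<Longrightarrow> v (x / y) = v x - v y"
  by (simp add: divide_inverse v_mult v_inverse)

lemma v_pi_power [simp]: "v (\<pi> ^ n) = int n"
  by (induction n) (auto simp: v_mult)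

lemma v_pi_powi [simp]: "v (\<pi> powi n) = n"
  by (auto simp: power_int_def v_inverse power_inverse)

text \<open>The fractional ideal generated by \<pi>^i. Zero is adjoined by hand, since
  \<open>v 0\<close> carries no meaning.\<close>

definition frac_ideal :: "int \<Rightarrow> 'k set" where
  "frac_ideal i = {x. x = 0 \<or> i \<le> v x}"

lemma val_ring_eq: "val_ring v = frac_ideal 0"
  by (simp add: val_ring_def frac_ideal_def)

lemma zero_in_frac_ideal [simp]: "0 \<in> frac_ideal i"
  by (simp add: frac_ideal_def)

lemma one_in_frac_ideal [simp]: "1 \<in> frac_ideal i \<longleftrightarrow> i \<le> 0"
  by (simp add: frac_ideal_def)

lemma powi_in_frac_ideal [simp]: "\<pi> powi n \<in> frac_ideal i \<longleftrightarrow> i \<le> n"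
  by (simp add: frac_ideal_def)

lemma frac_ideal_mono: "x \<in> frac_ideal j \<Longrightarrow> i \<le> j \<Longrightarrow> x \<in> frac_ideal i"
  by (auto simp: frac_ideal_def)

lemma frac_ideal_add: "x \<in> frac_ideal i \<Longrightarrow> y \<in> frac_ideal i \<Longrightarrow> x + y \<in> frac_ideal i"
  using v_add[of x y] by (fastforce simp: frac_ideal_def)

lemma frac_ideal_add_mono:
  "x \<in> frac_ideal i \<Longrightarrow> y \<in> frac_ideal j \<Longrightarrow> k \<le> i \<Longrightarrow> k \<le> j \<Longrightarrow> x + y \<in> frac_ideal k"
  by (intro frac_ideal_add) (auto elim: frac_ideal_mono)

lemma frac_ideal_minus [simp]: "- x \<in> frac_ideal i \<longleftrightarrow> x \<in> frac_ideal i"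
  by (simp add: frac_ideal_def)

lemma frac_ideal_diff: "x \<in> frac_ideal i \<Longrightarrow> y \<in> frac_ideal i \<Longrightarrow> x - y \<in> frac_ideal i"
  using frac_ideal_add[of x i "- y"] by simp

lemma frac_ideal_add_iff: "y \<in> frac_ideal i \<Longrightarrow> x + y \<in> frac_ideal i \<longleftrightarrow> x \<in> frac_ideal i"
  using frac_ideal_add[of x i y] frac_ideal_diff[of "x + y" i y] by auto

lemma frac_ideal_diff_iff: "y \<in> frac_ideal i \<Longrightarrow> x - y \<in> frac_ideal i \<longleftrightarrow> x \<in> frac_ideal i"
  using frac_ideal_add_iff[of "- y" i x] by simp

lemma frac_ideal_cong: "x - y \<in> frac_ideal i \<Longrightarrow> x \<in> frac_ideal i \<longleftrightarrow> y \<in> frac_ideal i"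
  using frac_ideal_add_iff[of "x - y" i y] by simp

lemma frac_ideal_mult: "x \<in> frac_ideal i \<Longrightarrow> y \<in> frac_ideal j \<Longrightarrow> x * y \<in> frac_ideal (i + j)"
  by (cases "x = 0 \<or> y = 0") (auto simp: frac_ideal_def v_mult)

lemma frac_ideal_mult0: "x \<in> frac_ideal 0 \<Longrightarrow> y \<in> frac_ideal j \<Longrightarrow> x * y \<in> frac_ideal j"
  using frac_ideal_mult[of x 0 y j] by simp

lemma mult_in_frac_ideal_iff: "u \<noteq> 0 \<Longrightarrow> u * x \<in> frac_ideal i \<longleftrightarrow> x \<in> frac_ideal (i - v u)"
  by (cases "x = 0") (auto simp: frac_ideal_def v_mult)

lemma div_in_frac_ideal_iff: "u \<noteq> 0 \<Longrightarrow> x / u \<in> frac_ideal i \<longleftrightarrow> x \<in> frac_ideal (i + v u)"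
  by (cases "x = 0") (auto simp: frac_ideal_def v_divide)

text \<open>A non-integral element is itself a unit times a negative power of \<pi>. An integral one
  is congruent to 1 modulo O, so \<open>m = 0\<close> stands for the trivial class.\<close>

lemma principal_part_eq_unit_mult_powi:
  obtains u m where "u \<noteq> 0" "v u = 0" "x - u * \<pi> powi (- int m) \<in> frac_ideal 0"
proof (cases "x \<in> frac_ideal 0")
  case True
  then show thesis
    using that[of 1 0] by (simp add: frac_ideal_diff)
next
  case False
  then have x: "x \<noteq> 0" "v x < 0"
    by (auto simp: frac_ideal_def)
  then show thesis
    using that[of "x / \<pi> powi v x" "nat (- v x)"] by (simp add: v_divide)
qed

end

subsection \<open>Lattices\<close>

locale valued_vector_space = vector_space smul + valued_field v \<pi>
  for smul :: "'k::field \<Rightarrow> 'v::ab_group_add \<Rightarrow> 'v" and v :: "'k \<Rightarrow> int" and \<pi> :: 'k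
begin

text \<open>The O-submodules. An \<open>O_span\<close> is bounded from above by testing such a set
  on the generators.\<close>

definition O_closed :: "'v set \<Rightarrow> bool" where
  "O_closed L \<longleftrightarrow> 0 \<in> L \<and> (\<forall>x\<in>L. \<forall>y\<in>L. x + y \<in> L) \<and> (\<forall>c\<in>frac_ideal 0. \<forall>x\<in>L. smul c x \<in> L)"

lemma O_closed_zero: "O_closed L \<Longrightarrow> 0 \<in> L"
  and O_closed_add: "O_closed L \<Longrightarrow> x \<in> L \<Longrightarrow> y \<in> L \<Longrightarrow> x + y \<in> L"
  and O_closed_scale: "O_closed L \<Longrightarrow> c \<in> frac_ideal 0 \<Longrightarrow> x \<in> L \<Longrightarrow> smul c x \<in> L"
  by (auto simp: O_closed_def)

lemma O_closed_diff:
  assumes "O_closed L" "x \<in> L" "y \<in> L"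
  shows "x - y \<in> L"
proof -
  have "smul (-1) y \<in> L"
    using assms by (intro O_closed_scale) auto
  then show ?thesis
    using O_closed_add[OF assms(1,2)] by fastforce
qed

lemma O_closed_sum:
  assumes "O_closed L" "\<And>i. i \<in> I \<Longrightarrow> g i \<in> L"
  shows "(\<Sum>i\<in>I. g i) \<in> L"
  using assms(2) by (induction I rule: infinite_finite_induct)
    (auto intro: O_closed_zero O_closed_add assms(1))

lemma O_span_minimal: "B \<subseteq> L \<Longrightarrow> O_closed L \<Longrightarrow> O_span smul v B \<subseteq> L"
  unfolding O_span_def val_ring_eq by (auto intro!: O_closed_sum O_closed_scale)

lemma O_closed_O_span: "O_closed (O_span smul v B)"
  unfolding O_closed_def
proof (intro conjI ballI)
  show "0 \<in> O_span smul v B"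
    unfolding O_span_def val_ring_eq by (auto intro!: exI[of _ "\<lambda>_. 0"])
  show "x + y \<in> O_span smul v B" if xy: "x \<in> O_span smul v B" "y \<in> O_span smul v B" for x y
  proof -
    obtain c c' where "x = (\<Sum>b\<in>B. smul (c b) b)" "c ` B \<subseteq> frac_ideal 0"
      "y = (\<Sum>b\<in>B. smul (c' b) b)" "c' ` B \<subseteq> frac_ideal 0"
      using xy unfolding O_span_def val_ring_eq by blast
    then show ?thesis
      unfolding O_span_def val_ring_eq
      by (auto intro!: exI[of _ "\<lambda>b. c b + c' b"] frac_ideal_add simp: scale_left_distrib sum.distrib)
  qed
  show "smul a x \<in> O_span smul v B" if ax: "a \<in> frac_ideal 0" "x \<in> O_span smul v B" for a x
  proof -
    obtain c where "x = (\<Sum>b\<in>B. smul (c b) b)" "c ` B \<subseteq> frac_ideal 0"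
      using ax unfolding O_span_def val_ring_eq by blast
    then show ?thesis
      using ax(1) unfolding O_span_def val_ring_eq
      by (auto intro!: exI[of _ "\<lambda>b. a * c b"] frac_ideal_mult0 simp: scale_sum_right)
  qed
qed

lemma O_span_superset: "finite B \<Longrightarrow> B \<subseteq> O_span smul v B"
proof
  fix b assume "finite B" "b \<in> B"
  then have "b = (\<Sum>x\<in>B. smul (if x = b then 1 else 0) x)"
    by (subst sum.remove[of B b]) auto
  then show "b \<in> O_span smul v B"
    unfolding O_span_def val_ring_eq
    by (auto intro!: exI[of _ "\<lambda>x. if x = b then 1 else 0"])
qed

lemma O_span_subset_span: "O_span smul v B \<subseteq> span B"
  unfolding O_span_def by (auto intro: span_sum span_scale span_base)

lemma span_O_span: "finite B \<Longrightarrow> span (O_span smul v B) = span B"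
  by (metis O_span_superset O_span_subset_span span_mono span_minimal subspace_span subset_antisym)

text \<open>\<open>O_span\<close> sums over a set and so merges repeated values of \<open>g\<close>.
  The sums over indices still form a submodule containing every \<open>g i\<close>, so minimality
  applies without injectivity.\<close>

lemma O_span_image:
  assumes "finite I"
  shows "O_span smul v (g ` I) = {(\<Sum>i\<in>I. smul (c i) (g i)) | c. c ` I \<subseteq> frac_ideal 0}"
    (is "_ = ?R")
proof
  show "?R \<subseteq> O_span smul v (g ` I)"
    using O_span_superset[of "g ` I"] assms
    by (auto intro!: O_closed_sum[OF O_closed_O_span] O_closed_scale[OF O_closed_O_span])
  show "O_span smul v (g ` I) \<subseteq> ?R"
  proof (rule O_span_minimal)
    show "g ` I \<subseteq> ?R"
    proof safe
      fix i assume "i \<in> I"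
      then have "g i = (\<Sum>j\<in>I. smul (if j = i then 1 else 0) (g j))"
        using assms by (subst sum.remove[of I i]) auto
      then show "\<exists>c. g i = (\<Sum>j\<in>I. smul (c j) (g j)) \<and> c ` I \<subseteq> frac_ideal 0"
        by (auto intro!: exI[of _ "\<lambda>j. if j = i then 1 else 0"])
    qed
    show "O_closed ?R"
      unfolding O_closed_def
    proof (intro conjI ballI)
      show "0 \<in> ?R"
        by (auto intro!: exI[of _ "\<lambda>_. 0"])
      show "x + y \<in> ?R" if xy: "x \<in> ?R" "y \<in> ?R" for x y
      proof -
        obtain c c' where "x = (\<Sum>i\<in>I. smul (c i) (g i))" "c ` I \<subseteq> frac_ideal 0"
          "y = (\<Sum>i\<in>I. smul (c' i) (g i))" "c' ` I \<subseteq> frac_ideal 0"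
          using xy by blast
        then show ?thesis
          by (auto intro!: exI[of _ "\<lambda>b. c b + c' b"] frac_ideal_add
            simp: scale_left_distrib sum.distrib)
      qed
      show "smul a x \<in> ?R" if ax: "a \<in> frac_ideal 0" "x \<in> ?R" for a x
      proof -
        obtain c where "x = (\<Sum>i\<in>I. smul (c i) (g i))" "c ` I \<subseteq> frac_ideal 0"
          using ax by blast
        then show ?thesis
          using ax(1) by (auto intro!: exI[of _ "\<lambda>b. a * c b"] frac_ideal_mult0
            simp: scale_sum_right)
      qed
    qed
  qed
qed

lemma O_closed_lattice: "L \<in> lattices smul v U \<Longrightarrow> O_closed L"
  unfolding lattices_def using O_closed_O_span by auto

lemma linear_image_in_lattices:
  assumes "module_hom smul smul T" "L \<in> lattices smul v U"
  shows "T ` L \<in> lattices smul v (T ` U)"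
proof -
  interpret T: module_hom smul smul T by fact
  obtain B where B: "finite B" "L = O_span smul v B" "span B = U"
    using assms unfolding lattices_def by auto
  have T_sum: "(\<Sum>b\<in>B. smul (c b) (T b)) = T (\<Sum>b\<in>B. smul (c b) b)" for c
    by (simp add: T.sum T.scale)
  have "O_span smul v (T ` B) = {\<Sum>b\<in>B. smul (c b) (T b) | c. c ` B \<subseteq> frac_ideal 0}"
    using O_span_image B by auto
  also have "\<dots> = T ` L"
    unfolding B(2) O_span_def val_ring_eq T_sum by blast
  finally show ?thesis
    unfolding lattices_def using B T.span_image[of B]
    by (intro CollectI exI[of _ "T ` B"]) simp
qed

text \<open>The map \<open>g\<close> projects onto the kernel of \<open>f\<close> along
  \<open>u\<close>. It preserves \<open>L\<close> because \<open>f u\<close> has the least valuation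
  on \<open>L\<close>, which makes \<open>f x / f u\<close> integral. Hence it sends generators of
  \<open>L\<close> to generators of the kernel part, and likewise for the spans over the
  field.\<close>

lemma lattice_kernel:
  assumes L: "L \<in> lattices smul v U" and f: "module_hom smul (*) f"
    and u: "u \<in> L" "f u \<noteq> 0" "\<And>x. x \<in> L \<Longrightarrow> f x \<in> frac_ideal (v (f u))"
  shows "{x \<in> L. f x = 0} \<in> lattices smul v {x \<in> U. f x = 0}"
proof -
  interpret f: module_hom smul "(*)" f by fact
  obtain B where B: "finite B" "L = O_span smul v B" "span B = U"
    using L unfolding lattices_def by auto
  define g where "g x = x - smul (f x / f u) u" for x
  have fg: "f (g x) = 0" for x
    using u by (simp add: g_def f.diff f.scale)
  have g_sum: "(\<Sum>b\<in>B. smul (c b) (g b)) = g (\<Sum>b\<in>B. smul (c b) b)" for c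
    by (simp add: g_def f.sum f.scale sum_divide_distrib scale_sum_left scale_right_diff_distrib
      sum_subtractf)
  have gid: "x \<in> g ` A" if "f x = 0" "x \<in> A" for x A
    using that by (simp add: g_def image_iff bexI[of _ x])
  have gL: "g x \<in> L" if "x \<in> L" for x
    unfolding g_def using that u O_closed_lattice[OF L]
    by (intro O_closed_diff O_closed_scale) (auto simp: div_in_frac_ideal_iff)
  have uU: "u \<in> U"
    using u B O_span_subset_span by blast
  have sU: "subspace U"
    using B subspace_span by blast
  have gU: "g x \<in> U" if "x \<in> U" for x
    unfolding g_def using that uU sU by (intro subspace_diff subspace_scale)
  have "O_span smul v (g ` B) = {\<Sum>b\<in>B. smul (c b) (g b) | c. c ` B \<subseteq> frac_ideal 0}"
    using O_span_image B by auto
  also have "\<dots> = g ` L"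
    unfolding B(2) O_span_def val_ring_eq g_sum by blast
  also have "\<dots> = {x \<in> L. f x = 0}"
    using gL fg by (auto intro: gid)
  finally have 1: "O_span smul v (g ` B) = {x \<in> L. f x = 0}" .
  have hom: "module_hom smul smul g"
    by unfold_locales (simp_all add: g_def f.add f.scale add_divide_distrib scale_left_distrib
      scale_right_distrib scale_right_diff_distrib)
  have "span (g ` B) = g ` span B"
    using module_hom.span_image[OF hom] by blast
  also have "\<dots> = {x \<in> U. f x = 0}"
    unfolding B(3) using gU fg by (auto intro: gid)
  finally show ?thesis
    unfolding lattices_def using B(1) 1
    by (intro CollectI exI[of _ "g ` B"]) simp
qed

text \<open>A generator at which \<open>f\<close> is nonzero of least valuation bounds
  \<open>f\<close> on all integral combinations. One exists, as otherwise \<open>f\<close> would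
  vanish on the whole span.\<close>

lemma lattice_pivot:
  assumes L: "L \<in> lattices smul v U" and f: "module_hom smul (*) f" and "\<exists>x\<in>U. f x \<noteq> 0"
  obtains u where "u \<in> L" "f u \<noteq> 0" "\<And>x. x \<in> L \<Longrightarrow> f x \<in> frac_ideal (v (f u))"
proof -
  interpret f: module_hom smul "(*)" f by fact
  obtain B where B: "finite B" "L = O_span smul v B" "span B = U"
    using L unfolding lattices_def by auto
  define C where "C = {b\<in>B. f b \<noteq> 0}"
  have "C \<noteq> {}"
  proof
    assume "C = {}"
    then have "f x = 0" if "x \<in> span B" for x
      using f.eq_0_on_span[of B x] that by (auto simp: C_def)
    then show False
      using assms B by auto
  qed
  then obtain u where "is_arg_min (\<lambda>b. v (f b)) (\<lambda>b. b \<in> C) u"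
    using ex_is_arg_min_if_finite[of C] B(1) by (auto simp: C_def)
  then have u: "u \<in> C" "\<forall>b\<in>C. v (f u) \<le> v (f b)"
    by (auto simp: is_arg_min_linorder)
  have "O_span smul v B \<subseteq> {x. f x \<in> frac_ideal (v (f u))}"
  proof (rule O_span_minimal)
    show "B \<subseteq> {x. f x \<in> frac_ideal (v (f u))}"
      using u by (auto simp: frac_ideal_def C_def)
    show "O_closed {x. f x \<in> frac_ideal (v (f u))}"
      by (auto simp: O_closed_def f.add f.scale f.zero frac_ideal_add frac_ideal_mult0)
  qed
  then show thesis
    using that[of u] u B O_span_superset[of B] by (auto simp: C_def)
qed

end

subsection \<open>Existence of standard representatives\<close>

abbreviation mat2 :: "'k \<Rightarrow> 'k \<Rightarrow> 'k \<Rightarrow> 'k \<Rightarrow> ('k::field)^2^2" where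
  "mat2 a b c d \<equiv> vector [vector [a, b], vector [c, d]]"

lemma det_mat2 [simp]: "det (mat2 a b c d) = a * d - b * c"
  by (simp add: det_2)

lemma det_nonzero_inverse:
  fixes A :: "'k::field^2^2"
  assumes "det A \<noteq> 0"
  obtains B where "A ** B = mat 1" "B ** A = mat 1" "det A * det B = 1"
proof -
  obtain B where "A ** B = mat 1" "B ** A = mat 1"
    using assms invertible_det_nz[of A] unfolding invertible_def by blast
  moreover from this(1) have "det A * det B = 1"
    by (metis det_mul det_I)
  ultimately show thesis
    using that by blast
qed

text \<open>Here W is the span of \<open>e1\<close> and \<open>e2\<close>, and D that of
  \<open>e3\<close>. Coordinates turn statements about lattices into conditions on
  valuations.\<close>

locale framed_space = valued_vector_space smul v \<pi>
  for smul :: "'k::field \<Rightarrow> 'v::ab_group_add \<Rightarrow> 'v" and v \<pi> +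
  fixes e1 e2 e3 :: 'v
  assumes frame_independent:
      "smul x e1 + smul y e2 + smul z e3 = 0 \<Longrightarrow> x = 0 \<and> y = 0 \<and> z = 0"
    and frame_spanning: "\<exists>x y z. w = smul x e1 + smul y e2 + smul z e3"
begin

definition vec :: "'k \<Rightarrow> 'k \<Rightarrow> 'k \<Rightarrow> 'v" where
  "vec x y z = smul x e1 + smul y e2 + smul z e3"

definition c1 :: "'v \<Rightarrow> 'k" where "c1 w = (SOME x. \<exists>y z. w = vec x y z)"
definition c2 :: "'v \<Rightarrow> 'k" where "c2 w = (SOME y. \<exists>x z. w = vec x y z)"
definition c3 :: "'v \<Rightarrow> 'k" where "c3 w = (SOME z. \<exists>x y. w = vec x y z)"

lemma vec_add: "vec x y z + vec x' y' z' = vec (x + x') (y + y') (z + z')"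
  by (simp add: vec_def scale_left_distrib algebra_simps)

lemma vec_scale: "smul a (vec x y z) = vec (a * x) (a * y) (a * z)"
  by (simp add: vec_def scale_right_distrib)

lemma vec_inject [simp]: "vec x y z = vec x' y' z' \<longleftrightarrow> x = x' \<and> y = y' \<and> z = z'"
proof
  assume "vec x y z = vec x' y' z'"
  then have "vec (x - x') (y - y') (z - z') = 0"
    by (simp add: vec_def scale_left_diff_distrib algebra_simps)
  then show "x = x' \<and> y = y' \<and> z = z'"
    using frame_independent[of "x - x'" "y - y'" "z - z'"] unfolding vec_def by simp
qed simp

lemma c1_vec [simp]: "c1 (vec x y z) = x"
  and c2_vec [simp]: "c2 (vec x y z) = y"
  and c3_vec [simp]: "c3 (vec x y z) = z"
  by (simp_all add: c1_def c2_def c3_def)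

lemma vec_coords [simp]: "vec (c1 w) (c2 w) (c3 w) = w"
proof -
  obtain x y z where "w = vec x y z"
    using frame_spanning[of w] unfolding vec_def by blast
  then show ?thesis by simp
qed

lemma eq_iff_coords: "w = w' \<longleftrightarrow> c1 w = c1 w' \<and> c2 w = c2 w' \<and> c3 w = c3 w'"
  by (metis vec_coords)

lemma coords_add [simp]:
  "c1 (w + w') = c1 w + c1 w'" "c2 (w + w') = c2 w + c2 w'" "c3 (w + w') = c3 w + c3 w'"
  using vec_add[of "c1 w" "c2 w" "c3 w" "c1 w'" "c2 w'" "c3 w'"] by simp_all

lemma coords_scale [simp]:
  "c1 (smul a w) = a * c1 w" "c2 (smul a w) = a * c2 w" "c3 (smul a w) = a * c3 w"
  using vec_scale[of a "c1 w" "c2 w" "c3 w"] by simp_all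

lemma coords_zero [simp]: "c1 0 = 0" "c2 0 = 0" "c3 0 = 0"
  using coords_scale[of 0 0] by simp_all

lemma coords_frame [simp]:
  "c1 e1 = 1" "c2 e1 = 0" "c3 e1 = 0"
  "c1 e2 = 0" "c2 e2 = 1" "c3 e2 = 0"
  "c1 e3 = 0" "c2 e3 = 0" "c3 e3 = 1"
  using c1_vec[of 1 0 0] c2_vec[of 1 0 0] c3_vec[of 1 0 0]
    c1_vec[of 0 1 0] c2_vec[of 0 1 0] c3_vec[of 0 1 0]
    c1_vec[of 0 0 1] c2_vec[of 0 0 1] c3_vec[of 0 0 1]
  unfolding vec_def by simp_all

lemma module_hom_coords: "module_hom smul (*) c1" "module_hom smul (*) c2" "module_hom smul (*) c3"
  by (unfold_locales; simp add: algebra_simps)+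

lemma coords_diff [simp]:
  "c1 (w - w') = c1 w - c1 w'" "c2 (w - w') = c2 w - c2 w'" "c3 (w - w') = c3 w - c3 w'"
  using module_hom.diff[OF module_hom_coords(1)] module_hom.diff[OF module_hom_coords(2)]
    module_hom.diff[OF module_hom_coords(3)] by auto

text \<open>The direct sum of the map with matrix \<open>A\<close> on W and the identity on
  D.\<close>

definition lin :: "'k^2^2 \<Rightarrow> 'v \<Rightarrow> 'v" where
  "lin A w = vec (A$1$1 * c1 w + A$1$2 * c2 w) (A$2$1 * c1 w + A$2$2 * c2 w) (c3 w)"

lemma coords_lin [simp]:
  "c1 (lin A w) = A$1$1 * c1 w + A$1$2 * c2 w"
  "c2 (lin A w) = A$2$1 * c1 w + A$2$2 * c2 w"
  "c3 (lin A w) = c3 w"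
  by (simp_all add: lin_def)

lemma lin_lin [simp]: "lin A (lin B w) = lin (A ** B) w"
  by (simp add: eq_iff_coords matrix_matrix_mult_def sum_2 algebra_simps)

lemma lin_mat1 [simp]: "lin (mat 1) w = w"
  by (simp add: eq_iff_coords mat_def)

lemma lin_lin_image [simp]: "lin A ` lin B ` S = lin (A ** B) ` S"
  by (simp add: image_image)

lemma lin_mat1_image [simp]: "lin (mat 1) ` S = S"
  by simp

lemma module_hom_lin: "module_hom smul smul (lin A)"
  by unfold_locales (simp_all add: eq_iff_coords algebra_simps)

text \<open>Every element of \<open>S'\<close> is the image of its translate by the inverse matrix,
  so the equivalence of memberships also gives surjectivity.\<close>

lemma lin_image_eqI:
  assumes "det A \<noteq> 0" and "\<And>w. lin A w \<in> S' \<longleftrightarrow> w \<in> S"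
  shows "lin A ` S = S'"
proof -
  obtain B where B: "A ** B = mat 1"
    using det_nonzero_inverse[OF assms(1)] by blast
  have "w \<in> lin A ` S" if "w \<in> S'" for w
  proof
    show "w = lin A (lin B w)"
      by (simp add: B)
    then show "lin B w \<in> S"
      using assms(2) that by metis
  qed
  then show ?thesis
    using assms(2) by auto
qed

section \<open>Lattices in coordinates, triangular bases and elementary divisors\<close>

definition plane :: "'v set" where "plane = {w. c3 w = 0}"

lemma lin_image_UNIV: "det A \<noteq> 0 \<Longrightarrow> lin A ` UNIV = UNIV"
  by (rule lin_image_eqI) auto

lemma lin_image_plane: "det A \<noteq> 0 \<Longrightarrow> lin A ` plane = plane"
  by (rule lin_image_eqI) (auto simp: plane_def)

lemma lin_image_lattices_plane:
  "det A \<noteq> 0 \<Longrightarrow> L \<in> lattices smul v plane \<Longrightarrow> lin A ` L \<in> lattices smul v plane"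
  using linear_image_in_lattices[OF module_hom_lin, of L plane A] by (simp add: lin_image_plane)

lemma lin_image_lattices_UNIV:
  "det A \<noteq> 0 \<Longrightarrow> L \<in> lattices smul v UNIV \<Longrightarrow> lin A ` L \<in> lattices smul v UNIV"
  using linear_image_in_lattices[OF module_hom_lin, of L UNIV A] by (simp add: lin_image_UNIV)

lemma lattice_plane_subset: "L \<in> lattices smul v plane \<Longrightarrow> L \<subseteq> plane"
  unfolding lattices_def using O_span_subset_span by blast

text \<open>The lattice generated by \<pi>^a e1, \<pi>^b e2 and \<pi>^c (X e1 + Y e2 + e3):
  subtracting \<open>X * c3 w\<close> and \<open>Y * c3 w\<close> removes the contribution of the
  third generator.\<close>

definition stdV :: "int \<Rightarrow> int \<Rightarrow> int \<Rightarrow> 'k \<Rightarrow> 'k \<Rightarrow> 'v set" where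
  "stdV a b c X Y = {w. c1 w - X * c3 w \<in> frac_ideal a \<and> c2 w - Y * c3 w \<in> frac_ideal b
     \<and> c3 w \<in> frac_ideal c}"

definition stdW :: "int \<Rightarrow> int \<Rightarrow> 'v set" where
  "stdW a b = {w. c1 w \<in> frac_ideal a \<and> c2 w \<in> frac_ideal b \<and> c3 w = 0}"

text \<open>Hermite normal form: \<open>u\<close> has a second coordinate of least valuation,
  \<open>t\<close> generates the part of \<open>L\<close> on the line of \<open>e1\<close>, and
  together they form a basis. The exponents \<open>i\<close> and \<open>j\<close> stay free so that
  any \<open>stdW i j\<close> can serve as the source.\<close>

lemma lattice_plane_triangular:
  assumes L: "L \<in> lattices smul v plane"
    and u: "u \<in> L" "c2 u \<noteq> 0" "\<And>x. x \<in> L \<Longrightarrow> c2 x \<in> frac_ideal (v (c2 u))"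
  obtains t where "t \<in> L" "c1 t \<noteq> 0"
    "\<And>i j. lin (mat2 (c1 t / \<pi> powi i) (c1 u / \<pi> powi j) 0 (c2 u / \<pi> powi j)) ` stdW i j = L"
proof -
  define K where "K = {x \<in> L. c2 x = 0}"
  have K: "K \<in> lattices smul v {x \<in> plane. c2 x = 0}"
    unfolding K_def using lattice_kernel[OF L module_hom_coords(2)] u by blast
  obtain t where t: "t \<in> K" "c1 t \<noteq> 0" "\<And>x. x \<in> K \<Longrightarrow> c1 x \<in> frac_ideal (v (c1 t))"
  proof (rule lattice_pivot[OF K module_hom_coords(1)])
    show "\<exists>x\<in>{x \<in> plane. c2 x = 0}. c1 x \<noteq> 0"
      by (rule bexI[of _ e1]) (auto simp: plane_def)
  qed (rule that)
  have OL: "O_closed L"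
    by (rule O_closed_lattice[OF L])
  have c3: "c3 x = 0" if "x \<in> L" for x
    using lattice_plane_subset[OF L] that by (auto simp: plane_def)
  have tL: "t \<in> L" "c2 t = 0" "c3 t = 0" "c3 u = 0"
    using t u c3 by (auto simp: K_def)
  \<comment> \<open>The two quotients are the coefficients of \<open>x\<close> at \<open>u\<close>
    and at \<open>t\<close>; the first does not involve \<open>t\<close> because
    \<open>c2 t = 0\<close>.\<close>
  have L_iff: "x \<in> L \<longleftrightarrow> c3 x = 0 \<and> c2 x / c2 u \<in> frac_ideal 0
      \<and> (c1 x - c2 x / c2 u * c1 u) / c1 t \<in> frac_ideal 0" (is "_ \<longleftrightarrow> ?R") for x
  proof
    assume x: "x \<in> L"
    then have a: "c2 x / c2 u \<in> frac_ideal 0"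
      using u by (simp add: div_in_frac_ideal_iff)
    have "x - smul (c2 x / c2 u) u \<in> K"
      unfolding K_def using O_closed_diff[OF OL x] O_closed_scale[OF OL a] u by simp
    then have "c1 (x - smul (c2 x / c2 u) u) \<in> frac_ideal (v (c1 t))"
      by (rule t)
    then show ?R
      using a c3[OF x] t by (simp add: div_in_frac_ideal_iff)
  next
    assume R: ?R
    have "x = smul (c2 x / c2 u) u + smul ((c1 x - c2 x / c2 u * c1 u) / c1 t) t"
      using R tL u t by (simp add: eq_iff_coords)
    moreover have "\<dots> \<in> L"
      using R tL u OL by (intro O_closed_add O_closed_scale) auto
    ultimately show "x \<in> L" by simp
  qed
  have "lin (mat2 (c1 t / \<pi> powi i) (c1 u / \<pi> powi j) 0 (c2 u / \<pi> powi j)) ` stdW i j = L" for i j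
  proof (rule lin_image_eqI)
    show "lin (mat2 (c1 t / \<pi> powi i) (c1 u / \<pi> powi j) 0 (c2 u / \<pi> powi j)) w \<in> L
      \<longleftrightarrow> w \<in> stdW i j" for w
      using u t unfolding L_iff stdW_def
      by (auto simp: div_in_frac_ideal_iff mult_in_frac_ideal_iff mult.commute[of "c2 w" "c1 u"])
  qed (use u t in simp)
  then show thesis
    using that tL t by blast
qed

lemma lin_upper_unit_image_stdW:
  assumes "a \<noteq> 0" "v a = 0" "c \<noteq> 0" "v c = 0" "b \<in> frac_ideal 0"
  shows "lin (mat2 a b 0 c) ` stdW s s = stdW s s"
proof (rule lin_image_eqI)
  show "lin (mat2 a b 0 c) w \<in> stdW s s \<longleftrightarrow> w \<in> stdW s s" for w
    using assms by (auto simp: stdW_def mult_in_frac_ideal_iff frac_ideal_mult0 frac_ideal_add_iff)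
qed (use assms in simp)

text \<open>The last assumption makes \<open>c2 u\<close> the coordinate of least valuation in all
  of \<open>M\<close>. Therefore the triangular matrix, rescaled by \<pi>^(r + d) and \<pi>^r, has
  integral entries and unit diagonal, and the difference of the exponents is a natural
  number.\<close>

lemma elementary_divisors_aux:
  assumes M: "M \<in> lattices smul v plane"
    and u: "u \<in> M" "c2 u \<noteq> 0" "\<And>x. x \<in> M \<Longrightarrow> c2 x \<in> frac_ideal (v (c2 u))"
    and c1: "\<And>x. x \<in> M \<Longrightarrow> c1 x \<in> frac_ideal (v (c2 u))"
  obtains A r d where "det A \<noteq> 0" "\<And>s. lin A ` stdW s s = stdW s s"
    "lin A ` stdW (r + int d) r = M"
proof -
  obtain t where t: "t \<in> M" "c1 t \<noteq> 0"
    "\<And>i j. lin (mat2 (c1 t / \<pi> powi i) (c1 u / \<pi> powi j) 0 (c2 u / \<pi> powi j)) ` stdW i j = M"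
    using lattice_plane_triangular[OF M u] by blast
  define r where "r = v (c2 u)"
  define d where "d = nat (v (c1 t) - r)"
  have d: "r + int d = v (c1 t)"
    using c1[OF t(1)] t(2) by (simp add: d_def r_def frac_ideal_def)
  define A where "A = mat2 (c1 t / \<pi> powi (r + int d)) (c1 u / \<pi> powi r) 0 (c2 u / \<pi> powi r)"
  show thesis
  proof (rule that)
    show "det A \<noteq> 0"
      using t u by (simp add: A_def)
    show "lin A ` stdW s s = stdW s s" for s
      unfolding A_def using t u c1[OF u(1)]
      by (intro lin_upper_unit_image_stdW)
        (auto simp: v_divide r_def div_in_frac_ideal_iff d[unfolded r_def])
    show "lin A ` stdW (r + int d) r = M"
      unfolding A_def by (rule t)
  qed
qed

text \<open>The pivot is whichever coordinate attains the least valuation on \<open>M\<close>. That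
  \<open>A\<close> lies in GL_2(O) is expressed by its preserving every
  \<open>stdW s s\<close>.\<close>

lemma elementary_divisors:
  assumes M: "M \<in> lattices smul v plane"
  obtains A r d where "det A \<noteq> 0" "\<And>s. lin A ` stdW s s = stdW s s"
    "lin A ` stdW (r + int d) r = M"
proof -
  have e: "e1 \<in> plane" "e2 \<in> plane"
    by (auto simp: plane_def)
  obtain u where u: "u \<in> M" "c2 u \<noteq> 0" "\<And>x. x \<in> M \<Longrightarrow> c2 x \<in> frac_ideal (v (c2 u))"
    using lattice_pivot[OF M module_hom_coords(2)] e coords_frame by (metis zero_neq_one)
  obtain u' where u': "u' \<in> M" "c1 u' \<noteq> 0" "\<And>x. x \<in> M \<Longrightarrow> c1 x \<in> frac_ideal (v (c1 u'))"
    using lattice_pivot[OF M module_hom_coords(1)] e coords_frame by (metis zero_neq_one)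
  show thesis
  proof (cases "v (c2 u) \<le> v (c1 u')")
    case True
    then show thesis
      using elementary_divisors_aux[OF M u] u' frac_ideal_mono that by metis
  next
    case False
    \<comment> \<open>Exchanging \<open>e1\<close> and \<open>e2\<close> brings the coordinate of
      least valuation into second place.\<close>
    define S :: "'k^2^2" where "S = mat2 0 1 1 0"
    have S: "det S \<noteq> 0" "S ** S = mat 1"
      by (auto simp: S_def vec_eq_iff matrix_matrix_mult_def forall_2 sum_2 mat_def)
    have cS: "c1 (lin S x) = c2 x" "c2 (lin S x) = c1 x" for x
      by (auto simp: S_def)
    have M': "lin S ` M \<in> lattices smul v plane"
      using lin_image_lattices_plane[OF S(1) M] .
    obtain A r d where A: "det A \<noteq> 0" "\<And>s. lin A ` stdW s s = stdW s s"
      "lin A ` stdW (r + int d) r = lin S ` M"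
    proof (rule elementary_divisors_aux[OF M'])
      show "lin S u' \<in> lin S ` M" using u' by blast
      show "c2 (lin S u') \<noteq> 0" using u' by (simp add: cS del: coords_lin)
      show "c2 x \<in> frac_ideal (v (c2 (lin S u')))" if "x \<in> lin S ` M" for x
        using that u' by (auto simp: cS simp del: coords_lin)
      show "c1 x \<in> frac_ideal (v (c2 (lin S u')))" if "x \<in> lin S ` M" for x
        using that False by (auto simp: cS simp del: coords_lin intro!: frac_ideal_mono[OF u(3)])
    qed (rule that)
    have SS: "lin S ` stdW s s = stdW s s" for s
      by (rule lin_image_eqI[OF S(1)]) (auto simp: stdW_def S_def)
    show thesis
    proof (rule that)
      show "det (S ** A) \<noteq> 0"
        using A S by (simp add: det_mul)
      show "lin (S ** A) ` stdW s s = stdW s s" for s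
        using A(2) SS lin_lin_image by metis
      show "lin (S ** A) ` stdW (r + int d) r = M"
        using A(3) S(2) lin_lin_image lin_mat1_image by metis
    qed
  qed
qed

text \<open>
  The pairs of lattices spanned by the columns of \<^const>\<open>matV\<close> and \<^const>\<open>matW\<close>, respectively of
  \<^const>\<open>matV0\<close> and \<^const>\<open>matW0\<close>.
\<close>

definition std_pair :: "quintuple \<Rightarrow> 'v set \<times> 'v set" where
  "std_pair = (\<lambda>(s, r, d, m, n).
     (stdV s s s (\<pi> powi (- int m)) (\<pi> powi (- int n)), stdW (r + int d) r))"

definition std_pair0 :: "int \<Rightarrow> quintuple \<Rightarrow> 'v set \<times> 'v set" where
  "std_pair0 k = (\<lambda>(s, r, d, m, n).
     (stdV (s + k) s s (\<pi> powi (k - int m)) (\<pi> powi (- int n)), stdW (k + int d + r) r))"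

definition mat_act :: "'k^2^2 \<Rightarrow> 'v set \<times> 'v set \<Rightarrow> 'v set \<times> 'v set" where
  "mat_act A p = (lin A ` fst p, lin A ` snd p)"

lemma mat_act_mult: "mat_act A (mat_act B p) = mat_act (A ** B) p"
  by (simp add: mat_act_def)

lemma mat_act_one [simp]: "mat_act (mat 1) p = p"
  by (simp add: mat_act_def)

section \<open>Reduction of a pair of lattices to a standard pair\<close>

lemma lattice_eq_stdV:
  assumes L: "L \<in> lattices smul v UNIV" and u: "u \<in> L" "c3 u \<noteq> 0"
    "\<And>x. x \<in> L \<Longrightarrow> c3 x \<in> frac_ideal (v (c3 u))" and K: "{x \<in> L. c3 x = 0} = stdW s s"
  shows "L = stdV s s (v (c3 u)) (c1 u / c3 u) (c2 u / c3 u)"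
proof (rule set_eqI)
  fix x
  have OL: "O_closed L"
    by (rule O_closed_lattice[OF L])
  have K': "x \<in> L \<Longrightarrow> c3 x = 0 \<Longrightarrow> x \<in> stdW s s" "x \<in> stdW s s \<Longrightarrow> x \<in> L" for x
    using K by auto
  show "x \<in> L \<longleftrightarrow> x \<in> stdV s s (v (c3 u)) (c1 u / c3 u) (c2 u / c3 u)" (is "_ \<longleftrightarrow> ?R")
  proof
    assume x: "x \<in> L"
    then have a: "c3 x / c3 u \<in> frac_ideal 0"
      using u by (simp add: div_in_frac_ideal_iff)
    \<comment> \<open>Clearing the third coordinate by an integral multiple of the pivot lands in
      the intersection of \<open>L\<close> with W.\<close>
    have "x - smul (c3 x / c3 u) u \<in> stdW s s"
      by (intro K'(1) O_closed_diff[OF OL x] O_closed_scale[OF OL a] u) (simp add: u)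
    then show ?R
      using u(3)[OF x] by (simp add: stdW_def stdV_def mult.commute)
  next
    assume R: ?R
    have "x - smul (c3 x / c3 u) u \<in> L"
      using R u by (intro K'(2)) (simp add: stdW_def stdV_def mult.commute)
    moreover have "c3 x / c3 u \<in> frac_ideal 0"
      using R u by (simp add: div_in_frac_ideal_iff stdV_def)
    ultimately have "(x - smul (c3 x / c3 u) u) + smul (c3 x / c3 u) u \<in> L"
      using u(1) by (intro O_closed_add[OF OL] O_closed_scale[OF OL])
    then show "x \<in> L" by simp
  qed
qed

text \<open>H fixes the third coordinate, which therefore dictates \<open>s\<close>. The freedom in
  H is spent in three stages: \<open>A1\<close> carries \<open>stdW s s\<close> to the intersection
  of \<open>L\<close> with W; \<open>A2\<close> preserves \<open>stdW s s\<close> and diagonalizes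
  the pullback of \<open>M\<close>; the diagonal units in \<open>C\<close> preserve both of these
  and normalize the third generator.\<close>

lemma mat_act_std_pair_surj:
  assumes L: "L \<in> lattices smul v UNIV" and M: "M \<in> lattices smul v plane"
  obtains A q where "det A \<noteq> 0" "(L, M) = mat_act A (std_pair q)"
proof -
  obtain u where u: "u \<in> L" "c3 u \<noteq> 0" "\<And>x. x \<in> L \<Longrightarrow> c3 x \<in> frac_ideal (v (c3 u))"
    using lattice_pivot[OF L module_hom_coords(3)] coords_frame by (metis zero_neq_one UNIV_I)
  define s where "s = v (c3 u)"
  define K where "K = {x \<in> L. c3 x = 0}"
  have K: "K \<in> lattices smul v plane"
    unfolding K_def plane_def using lattice_kernel[OF L module_hom_coords(3) u] by simp
  have e: "e2 \<in> plane"
    by (auto simp: plane_def)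
  obtain u' where u': "u' \<in> K" "c2 u' \<noteq> 0" "\<And>x. x \<in> K \<Longrightarrow> c2 x \<in> frac_ideal (v (c2 u'))"
    using lattice_pivot[OF K module_hom_coords(2)] e coords_frame by (metis zero_neq_one)
  obtain A1 where A1: "det A1 \<noteq> 0" "lin A1 ` stdW s s = K"
  proof (rule lattice_plane_triangular[OF K u'])
    fix t assume "t \<in> K" "c1 t \<noteq> 0"
      "\<And>i j. lin (mat2 (c1 t / \<pi> powi i) (c1 u' / \<pi> powi j) 0 (c2 u' / \<pi> powi j)) ` stdW i j = K"
    then show thesis
      using u' by (intro that[of "mat2 (c1 t / \<pi> powi s) (c1 u' / \<pi> powi s) 0 (c2 u' / \<pi> powi s)"])
        auto
  qed
  obtain B1 where B1: "A1 ** B1 = mat 1" "det A1 * det B1 = 1"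
    using det_nonzero_inverse[OF A1(1)] by blast
  then have "det B1 \<noteq> 0" by auto
  from lin_image_lattices_plane[OF this M]
  obtain A2 r d where A2: "det A2 \<noteq> 0" "\<And>s. lin A2 ` stdW s s = stdW s s"
    "lin A2 ` stdW (r + int d) r = lin B1 ` M"
    using elementary_divisors by metis
  define A where "A = A1 ** A2"
  have A: "det A \<noteq> 0" "lin A ` stdW s s = K" "lin A ` stdW (r + int d) r = M"
  proof -
    show "det A \<noteq> 0"
      using A1 A2 by (simp add: A_def det_mul)
    show "lin A ` stdW s s = K"
      unfolding A_def using A1(2) A2(2) lin_lin_image by metis
    show "lin A ` stdW (r + int d) r = M"
      unfolding A_def using A2(3) B1(1) lin_lin_image lin_mat1_image by metis
  qed
  obtain B where B: "A ** B = mat 1" "B ** A = mat 1" "det A * det B = 1"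
    using det_nonzero_inverse[OF A(1)] by blast
  have BA: "lin B (lin A w) = w" for w
    by (simp add: B)
  have "det B \<noteq> 0" using B(3) by auto
  from lin_image_lattices_UNIV[OF this L] have L2: "lin B ` L \<in> lattices smul v UNIV" .
  have "{x \<in> lin B ` L. c3 x = 0} = lin B ` K"
    by (auto simp: K_def)
  also have "\<dots> = stdW s s"
    unfolding A(2)[symmetric] by (simp add: image_image BA B)
  finally have K2: "{x \<in> lin B ` L. c3 x = 0} = stdW s s" .
  \<comment> \<open>Up to a factor \<open>c3 u\<close> the third generator is X e1 + Y e2 +
    e3.\<close>
  define X where "X = c1 (lin B u) / c3 u"
  define Y where "Y = c2 (lin B u) / c3 u"
  have LXY: "lin B ` L = stdV s s s X Y"
  proof -
    have "c3 x \<in> frac_ideal (v (c3 (lin B u)))" if "x \<in> lin B ` L" for x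
      using that u by auto
    from lattice_eq_stdV[OF L2 _ _ this K2] show ?thesis
      using u by (simp add: s_def X_def Y_def del: coords_lin(1,2))
  qed
  \<comment> \<open>\<open>X\<close> and \<open>Y\<close> matter only modulo O, since they are
    multiplied by third coordinates from \<pi>^s O.\<close>
  obtain a m where a: "a \<noteq> 0" "v a = 0" "X - a * \<pi> powi (- int m) \<in> frac_ideal 0"
    using principal_part_eq_unit_mult_powi[of X] by metis
  obtain b n where b: "b \<noteq> 0" "v b = 0" "Y - b * \<pi> powi (- int n) \<in> frac_ideal 0"
    using principal_part_eq_unit_mult_powi[of Y] by metis
  define C where "C = mat2 a 0 0 b"
  have detC: "det C \<noteq> 0"
    using a b by (simp add: C_def)
  have C2: "lin C ` stdW (r + int d) r = stdW (r + int d) r"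
    using a b by (intro lin_image_eqI[OF detC]) (simp add: stdW_def C_def mult_in_frac_ideal_iff)
  have C1: "lin C ` stdV s s s (\<pi> powi (- int m)) (\<pi> powi (- int n)) = stdV s s s X Y"
  proof (rule lin_image_eqI[OF detC])
    fix w
    have "a * c1 w - X * c3 w \<in> frac_ideal s
        \<longleftrightarrow> c1 w - \<pi> powi (- int m) * c3 w \<in> frac_ideal s" if "c3 w \<in> frac_ideal s"
    proof -
      have "a * c1 w - X * c3 w
          = a * (c1 w - \<pi> powi (- int m) * c3 w) - (X - a * \<pi> powi (- int m)) * c3 w"
        by (simp add: algebra_simps)
      moreover have "(X - a * \<pi> powi (- int m)) * c3 w \<in> frac_ideal s"
        using a that by (intro frac_ideal_mult0)
      ultimately show ?thesis
        using a by (simp only: frac_ideal_diff_iff) (simp add: mult_in_frac_ideal_iff)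
    qed
    moreover have "b * c2 w - Y * c3 w \<in> frac_ideal s
        \<longleftrightarrow> c2 w - \<pi> powi (- int n) * c3 w \<in> frac_ideal s" if "c3 w \<in> frac_ideal s"
    proof -
      have "b * c2 w - Y * c3 w
          = b * (c2 w - \<pi> powi (- int n) * c3 w) - (Y - b * \<pi> powi (- int n)) * c3 w"
        by (simp add: algebra_simps)
      moreover have "(Y - b * \<pi> powi (- int n)) * c3 w \<in> frac_ideal s"
        using b that by (intro frac_ideal_mult0)
      ultimately show ?thesis
        using b by (simp only: frac_ideal_diff_iff) (simp add: mult_in_frac_ideal_iff)
    qed
    ultimately show "lin C w \<in> stdV s s s X Y
        \<longleftrightarrow> w \<in> stdV s s s (\<pi> powi (- int m)) (\<pi> powi (- int n))"
      by (auto simp: stdV_def C_def)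
  qed
  have "mat_act C (std_pair (s, r, d, m, n)) = (lin B ` L, stdW (r + int d) r)"
    by (simp add: mat_act_def std_pair_def C1 C2 LXY)
  moreover have "mat_act A (lin B ` L, stdW (r + int d) r) = (L, M)"
    by (simp add: mat_act_def A B)
  ultimately have "(L, M) = mat_act (A ** C) (std_pair (s, r, d, m, n))"
    by (simp only: mat_act_mult[symmetric])
  then show thesis
    using that[of "A ** C" "(s, r, d, m, n)"] A(1) detC by (simp add: B det_mul)
qed

end

subsection \<open>The invariants of a pair\<close>

text \<open>For \<open>m = 0\<close> the first entry of the offset is integral, hence trivial, and
  must not contribute the shift by \<open>d\<close>.\<close>

definition quint_inv :: "quintuple \<Rightarrow> int \<times> int \<times> nat \<times> nat \<times> nat" where
  "quint_inv = (\<lambda>(s, r, d, m, n). (s, r, d, max m n, max n (if m = 0 then 0 else m + d)))"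

text \<open>For \<open>d = 0\<close> the entries can be exchanged, so this case is decided first.
  For \<open>d > 0\<close> exactly the quintuples with \<open>m < n < m + d\<close> admit no
  reduction and are kept.\<close>

definition quint_nf :: "quintuple \<Rightarrow> quintuple" where
  "quint_nf = (\<lambda>(s, r, d, m, n).
     if d = 0 then (s, r, d, 0, max m n)
     else if n \<le> m then (s, r, d, m, 0)
     else if m + d \<le> n then (s, r, d, 0, n) else (s, r, d, m, n))"

lemma equivclp_quint_nf: "equivclp quint_step q (quint_nf q)"
proof -
  obtain s r d m n where q: "q = (s, r, d, m, n)"
    by (cases q)
  have m0: "m + d \<le> n \<Longrightarrow> equivclp quint_step (s, r, d, m, n) (s, r, d, 0, n)" for m n
    by (intro r_into_equivclp quint_step.intros)
  have n0: "n \<le> m \<Longrightarrow> equivclp quint_step (s, r, d, m, n) (s, r, d, m, 0)" for m n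
    by (intro r_into_equivclp quint_step.intros)
  \<comment> \<open>The exchange passes through (m, m): the second rule, read backwards, raises 0 to
    m, and the first rule then removes the other entry.\<close>
  have "equivclp quint_step (s, r, d, m, n) (s, r, d, 0, m)" if "d = 0" "n \<le> m"
  proof -
    have "equivclp quint_step (s, r, d, m, 0) (s, r, d, m, m)"
      by (rule equivclp_sym, rule n0) simp
    moreover have "equivclp quint_step (s, r, d, m, m) (s, r, d, 0, m)"
      using that(1) by (intro m0) simp
    ultimately show ?thesis
      using n0[OF that(2)] by (blast intro: equivclp_trans)
  qed
  then show ?thesis
    using m0 n0 by (auto simp: q quint_nf_def max_def)
qed

text \<open>Let a and b be the last two invariants. For \<open>d > 0\<close> the normal form ends in
  (0, a) if b = a, in (a, 0) if b = a + d, and in (b - d, a) otherwise; for \<open>d = 0\<close> it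
  ends in (0, a).\<close>

lemma quint_nf_eq: "quint_inv q = quint_inv q' \<Longrightarrow> quint_nf q = quint_nf q'"
  by (cases q; cases q') (auto simp: quint_inv_def quint_nf_def max_def split: if_splits)

lemma equivclp_quint_step_if_inv_eq: "quint_inv q = quint_inv q' \<Longrightarrow> equivclp quint_step q q'"
  using quint_nf_eq[of q q'] equivclp_quint_nf[of q] equivclp_quint_nf[of q']
  by (metis equivclp_sym equivclp_trans)

section \<open>Matrices realizing the equivalence, and the determinant bound\<close>

context framed_space
begin

lemma mat_act_std_pair_step:
  assumes "quint_step q q'"
  obtains A where "det A \<noteq> 0" "mat_act A (std_pair q) = std_pair q'"
  using assms
proof cases
  case (1 m d n s r)
  \<comment> \<open>Subtracting \<open>p\<close> times the second coordinate cancels the first entry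
    of the offset; the target entry 1 = \<pi>^0 equals 0 modulo O. The second lattice survives
    because the valuation n - m of \<open>p\<close> is at least \<open>d\<close>.\<close>
  define p where "p = \<pi> powi (int n - int m)"
  have p: "p \<in> frac_ideal (int d)" "p * \<pi> powi (- int n) = \<pi> powi (- int m)"
    using 1 by (auto simp: p_def power_int_add[symmetric])
  define A where "A = mat2 1 (- p) 0 1"
  have A: "det A \<noteq> 0"
    by (simp add: A_def)
  have "lin A ` stdV s s s (\<pi> powi (- int m)) (\<pi> powi (- int n)) = stdV s s s 1 (\<pi> powi (- int n))"
  proof (rule lin_image_eqI[OF A])
    fix w
    have "c1 w - p * c2 w - c3 w \<in> frac_ideal s \<longleftrightarrow> c1 w - \<pi> powi (- int m) * c3 w \<in> frac_ideal s"
      if "c2 w - \<pi> powi (- int n) * c3 w \<in> frac_ideal s" "c3 w \<in> frac_ideal s"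
    proof (rule frac_ideal_cong)
      have "- (p * (c2 w - \<pi> powi (- int n) * c3 w)) - c3 w \<in> frac_ideal s"
        using that frac_ideal_mult0[OF frac_ideal_mono[OF p(1)] that(1)]
        by (intro frac_ideal_diff) auto
      then show "c1 w - p * c2 w - c3 w - (c1 w - \<pi> powi (- int m) * c3 w) \<in> frac_ideal s"
        by (simp add: algebra_simps flip: p(2))
    qed
    then show "lin A w \<in> stdV s s s 1 (\<pi> powi (- int n))
        \<longleftrightarrow> w \<in> stdV s s s (\<pi> powi (- int m)) (\<pi> powi (- int n))"
      by (auto simp: A_def stdV_def)
  qed
  moreover have "lin A ` stdW (r + int d) r = stdW (r + int d) r"
  proof (rule lin_image_eqI[OF A])
    fix w
    have "c1 w - p * c2 w \<in> frac_ideal (r + int d) \<longleftrightarrow> c1 w \<in> frac_ideal (r + int d)"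
      if "c2 w \<in> frac_ideal r"
      using frac_ideal_mult[OF p(1) that] by (intro frac_ideal_diff_iff) (simp add: add.commute)
    then show "lin A w \<in> stdW (r + int d) r \<longleftrightarrow> w \<in> stdW (r + int d) r"
      by (auto simp: A_def stdW_def)
  qed
  ultimately show thesis
    using that[OF A] 1 by (simp add: std_pair_def mat_act_def)
next
  case (2 n m s r d)
  \<comment> \<open>Now \<open>p\<close> sits in the lower left corner, where integrality suffices
    because r + d \<ge> r.\<close>
  define p where "p = \<pi> powi (int m - int n)"
  have p: "p \<in> frac_ideal 0" "p * \<pi> powi (- int m) = \<pi> powi (- int n)"
    using 2 by (auto simp: p_def power_int_add[symmetric])
  define A where "A = mat2 1 0 (- p) 1"
  have A: "det A \<noteq> 0"
    by (simp add: A_def)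
  have "lin A ` stdV s s s (\<pi> powi (- int m)) (\<pi> powi (- int n)) = stdV s s s (\<pi> powi (- int m)) 1"
  proof (rule lin_image_eqI[OF A])
    fix w
    have "c2 w - p * c1 w - c3 w \<in> frac_ideal s \<longleftrightarrow> c2 w - \<pi> powi (- int n) * c3 w \<in> frac_ideal s"
      if "c1 w - \<pi> powi (- int m) * c3 w \<in> frac_ideal s" "c3 w \<in> frac_ideal s"
    proof (rule frac_ideal_cong)
      have "- (p * (c1 w - \<pi> powi (- int m) * c3 w)) - c3 w \<in> frac_ideal s"
        using that frac_ideal_mult0[OF p(1) that(1)]
        by (intro frac_ideal_diff) auto
      then show "c2 w - p * c1 w - c3 w - (c2 w - \<pi> powi (- int n) * c3 w) \<in> frac_ideal s"
        by (simp add: algebra_simps flip: p(2))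
    qed
    then show "lin A w \<in> stdV s s s (\<pi> powi (- int m)) 1
        \<longleftrightarrow> w \<in> stdV s s s (\<pi> powi (- int m)) (\<pi> powi (- int n))"
      by (auto simp: A_def stdV_def)
  qed
  moreover have "lin A ` stdW (r + int d) r = stdW (r + int d) r"
  proof (rule lin_image_eqI[OF A])
    fix w
    have "c2 w - p * c1 w \<in> frac_ideal r \<longleftrightarrow> c2 w \<in> frac_ideal r"
      if "c1 w \<in> frac_ideal (r + int d)"
      using frac_ideal_mult[OF p(1) that]
      by (intro frac_ideal_diff_iff) (auto intro: frac_ideal_mono)
    then show "lin A w \<in> stdW (r + int d) r \<longleftrightarrow> w \<in> stdW (r + int d) r"
      by (auto simp: A_def stdW_def)
  qed
  ultimately show thesis
    using that[OF A] 2 by (simp add: std_pair_def mat_act_def)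
qed

text \<open>The matrix diag(\<pi>^k, 1) has determinant of valuation \<open>k\<close>, so these
  translates realize every valuation once.\<close>

lemma mat_act_std_pair0:
  "mat_act (mat2 (\<pi> powi k) 0 0 1) (std_pair q) = std_pair0 k q"
proof -
  obtain s r d m n where q: "q = (s, r, d, m, n)"
    by (cases q)
  let ?A = "mat2 (\<pi> powi k) 0 0 1"
  have A: "det ?A \<noteq> 0" by simp
  have "\<pi> powi k * c1 w - \<pi> powi (k - int m) * c3 w = \<pi> powi k * (c1 w - \<pi> powi (- int m) * c3 w)" for w
    by (simp add: algebra_simps power_int_diff power_int_minus_divide)
  then have "lin ?A ` stdV s s s (\<pi> powi (- int m)) (\<pi> powi (- int n))
      = stdV (s + k) s s (\<pi> powi (k - int m)) (\<pi> powi (- int n))"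
    by (intro lin_image_eqI[OF A]) (simp add: stdV_def mult_in_frac_ideal_iff)
  moreover have "lin ?A ` stdW (r + int d) r = stdW (k + int d + r) r"
    by (intro lin_image_eqI[OF A]) (simp add: stdW_def mult_in_frac_ideal_iff add.commute)
  ultimately show ?thesis
    by (simp add: q std_pair_def std_pair0_def mat_act_def)
qed

lemma std_pair0_zero: "std_pair0 0 q = std_pair q"
  by (simp add: std_pair_def std_pair0_def add.commute split: prod.splits)

text \<open>A comparison of covolumes of the second lattices: testing \<open>A\<close> on the two
  generators bounds its four entries, and both products in the determinant then lie in \<pi>^(j - k)
  O.\<close>

lemma std_pair0_det_bound:
  assumes A: "det A \<noteq> 0" and act: "mat_act A (std_pair0 k q) = std_pair0 j q"
  shows "j \<le> v (det A) + k"
proof -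
  obtain s r d m n where q: "q = (s, r, d, m, n)"
    by (cases q)
  have M: "lin A w \<in> stdW (j + int d + r) r" if "w \<in> stdW (k + int d + r) r" for w
    using act that by (auto simp: mat_act_def std_pair0_def q)
  have "A$1$1 \<in> frac_ideal (j - k)" "A$2$1 \<in> frac_ideal (- k - int d)"
    using M[of "vec (\<pi> powi (k + int d + r)) 0 0"]
    by (auto simp: stdW_def mult.commute[of "A$_$_"] mult_in_frac_ideal_iff)
  moreover have "A$1$2 \<in> frac_ideal (j + int d)" "A$2$2 \<in> frac_ideal 0"
    using M[of "vec 0 (\<pi> powi r) 0"]
    by (auto simp: stdW_def mult.commute[of "A$_$_"] mult_in_frac_ideal_iff)
  ultimately have "det A \<in> frac_ideal (j - k)"
    unfolding det_2 using frac_ideal_mult[of "A$1$1" "j - k" "A$2$2" 0]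
      frac_ideal_mult[of "A$1$2" "j + int d" "A$2$1" "- k - int d"]
    by (intro frac_ideal_diff) auto
  then show ?thesis
    using A by (simp add: frac_ideal_def)
qed

section \<open>Bounds on the invariants\<close>

definition proj :: "'v \<Rightarrow> 'v" where "proj w = vec (c1 w) (c2 w) 0"

text \<open>H preserves W and fixes D, hence respects the projection to W along D; this makes
  conditions on the offset of a lattice transportable.\<close>

lemma lin_proj: "lin A (proj w) = proj (lin A w)"
  by (simp add: proj_def eq_iff_coords)

lemma coords_proj [simp]: "c1 (proj w) = c1 w" "c2 (proj w) = c2 w" "c3 (proj w) = 0"
  by (simp_all add: proj_def)

lemma lin_scale: "lin A (smul c w) = smul c (lin A w)"
  by (simp add: eq_iff_coords algebra_simps)

lemma lin_add: "lin A (w + w') = lin A w + lin A w'"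
  by (simp add: eq_iff_coords algebra_simps)

text \<open>
  Each of the following bounds is proved by transporting a lattice condition that is preserved by
  \<open>H\<close> and testing it on a generator of the image; applied to the inverse as well, they show that
  the invariants agree.
\<close>

lemma mat_act_std_pair_le1:
  assumes "mat_act A (std_pair (s, r, d, m, n)) = std_pair (s', r', d', m', n')"
  shows "s' \<le> s"
proof -
  \<comment> \<open>This generator has third coordinate \<pi>^s, which \<open>lin A\<close> does not
    change.\<close>
  have "vec (\<pi> powi s * \<pi> powi (- int m)) (\<pi> powi s * \<pi> powi (- int n)) (\<pi> powi s)
      \<in> fst (std_pair (s, r, d, m, n))"
    by (simp add: std_pair_def stdV_def mult.commute)
  then have "lin A (vec (\<pi> powi s * \<pi> powi (- int m)) (\<pi> powi s * \<pi> powi (- int n)) (\<pi> powi s))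
      \<in> fst (mat_act A (std_pair (s, r, d, m, n)))"
    by (simp add: mat_act_def)
  then show ?thesis
    unfolding assms by (simp add: std_pair_def stdV_def)
qed

lemma mat_act_std_pair_le2:
  assumes act: "mat_act A (std_pair (s, r, d, m, n)) = std_pair (s, r', d', m', n')"
  shows "r' + int d' \<le> r + int d" "r \<le> r'"
proof -
  let ?L = "\<lambda>m n. stdV s s s (\<pi> powi (- int m)) (\<pi> powi (- int n))"
  have L: "lin A ` ?L m n = ?L m' n'" and M: "lin A ` stdW (r + int d) r = stdW (r' + int d') r'"
    using act by (auto simp: mat_act_def std_pair_def)
  \<comment> \<open>Scaling by \<pi>^(r + d - s) takes the W-part of the first lattice into the
    second one; \<pi>^s e1 tests this. Below, \<pi>^(s - r) takes the second lattice into the first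
    one, tested on \<pi>^r' e2.\<close>
  have "smul (\<pi> powi (r + int d - s)) w \<in> stdW (r' + int d') r'" if w: "w \<in> ?L m' n'" "c3 w = 0" for w
  proof -
    obtain u where u: "u \<in> ?L m n" "w = lin A u"
      using w(1) unfolding L[symmetric] by blast
    then have "smul (\<pi> powi (r + int d - s)) u \<in> stdW (r + int d) r"
      using w(2) by (auto simp: stdV_def stdW_def mult_in_frac_ideal_iff intro: frac_ideal_mono)
    then show ?thesis
      unfolding M[symmetric] u lin_scale[symmetric] by blast
  qed
  from this[of "vec (\<pi> powi s) 0 0"] show "r' + int d' \<le> r + int d"
    by (simp add: stdV_def stdW_def mult_in_frac_ideal_iff)
  have "smul (\<pi> powi (s - r)) w \<in> ?L m' n'" if w: "w \<in> stdW (r' + int d') r'" for w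
  proof -
    obtain u where u: "u \<in> stdW (r + int d) r" "w = lin A u"
      using w(1) unfolding M[symmetric] by blast
    then have "smul (\<pi> powi (s - r)) u \<in> ?L m n"
      by (auto simp: stdV_def stdW_def mult_in_frac_ideal_iff intro: frac_ideal_mono)
    then show ?thesis
      unfolding L[symmetric] u lin_scale[symmetric] by blast
  qed
  from this[of "vec 0 (\<pi> powi r') 0"] show "r \<le> r'"
    by (simp add: stdV_def stdW_def mult_in_frac_ideal_iff)
qed

lemma mat_act_std_pair_le3:
  assumes act: "mat_act A (std_pair (s, r, d, m, n)) = std_pair (s, r, d, m', n')"
  shows "max m' n' \<le> max m n"
    and "max n' (if m' = 0 then 0 else m' + d) \<le> max n (if m = 0 then 0 else m + d)"
proof -
  let ?L = "\<lambda>m n. stdV s s s (\<pi> powi (- int m)) (\<pi> powi (- int n))"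
  let ?M = "stdW (r + int d) r"
  have L: "lin A ` ?L m n = ?L m' n'" and M: "lin A ` ?M = ?M"
    using act by (auto simp: mat_act_def std_pair_def)
  have L_iff: "w \<in> ?L m n \<longleftrightarrow> c1 w - \<pi> powi (- int m) * c3 w \<in> frac_ideal s
    \<and> c2 w - \<pi> powi (- int n) * c3 w \<in> frac_ideal s \<and> c3 w \<in> frac_ideal s" for w m n
    by (simp add: stdV_def)
  have pow_c3: "\<pi> powi (- int i) * c3 u \<in> frac_ideal (s - int i)" if "u \<in> ?L m n" for u i
    using that by (simp add: L_iff mult_in_frac_ideal_iff)
  define g where "g = vec (\<pi> powi (s - int m')) (\<pi> powi (s - int n')) (\<pi> powi s)"
  have g: "g \<in> ?L m' n'"
    by (simp add: g_def L_iff power_int_add[symmetric])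
  then obtain u where u: "u \<in> ?L m n" "g = lin A u"
    unfolding L[symmetric] by blast
  \<comment> \<open>For every \<open>u\<close> in the first lattice \<pi>^t annihilates the class of
    \<open>proj u\<close> modulo its W-part. Transported to \<open>g\<close>, this bounds both
    \<open>m'\<close> and \<open>n'\<close> by \<open>t\<close>.\<close>
  define t where "t = max m n"
  have "c1 u \<in> frac_ideal (s - int t)" "c2 u \<in> frac_ideal (s - int t)"
    using u(1) frac_ideal_add_mono[OF _ pow_c3[OF u(1), of m], of "c1 u - \<pi> powi (- int m) * c3 u"]
      frac_ideal_add_mono[OF _ pow_c3[OF u(1), of n], of "c2 u - \<pi> powi (- int n) * c3 u"]
    unfolding L_iff t_def by auto
  then have "smul (\<pi> powi int t) (proj u) \<in> ?L m n"
    unfolding L_iff by (simp add: mult_in_frac_ideal_iff del: power_int_of_nat)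
  then have "smul (\<pi> powi int t) (proj g) \<in> ?L m' n'"
    unfolding L[symmetric] u(2) lin_proj[symmetric] lin_scale[symmetric] by blast
  then show "max m' n' \<le> max m n"
    by (simp add: L_iff g_def mult_in_frac_ideal_iff t_def del: power_int_of_nat)
  \<comment> \<open>The projection of \<open>u\<close> splits as \<open>y\<close>, in the W-part of
    the first lattice, plus \<pi>^(s - r - t) times \<open>x\<close>, in the second lattice. If
    \<open>m = 0\<close>, the first coordinate is already integral relative to \<pi>^s and goes to
    \<open>y\<close> entirely.\<close>
  define t where "t = max n (if m = 0 then 0 else m + d)"
  define x where "x = smul (\<pi> powi (r + int t - s))
    (vec (if m = 0 then 0 else \<pi> powi (- int m) * c3 u) (\<pi> powi (- int n) * c3 u) 0)"
  define y where "y = vec (c1 u - (if m = 0 then 0 else \<pi> powi (- int m) * c3 u))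
    (c2 u - \<pi> powi (- int n) * c3 u) 0"
  have x: "x \<in> ?M"
    using pow_c3[OF u(1), of m] pow_c3[OF u(1), of n]
    by (auto simp: x_def stdW_def mult_in_frac_ideal_iff t_def intro: frac_ideal_mono)
  have y: "y \<in> ?L m n"
    using u(1) frac_ideal_add[of "c1 u - c3 u" s "c3 u"] by (auto simp: y_def L_iff)
  have "proj u = y + smul (\<pi> powi (s - r - int t)) x"
    by (auto simp: eq_iff_coords x_def y_def mult.assoc[symmetric] power_int_add[symmetric])
  then have gxy: "proj g = lin A y + smul (\<pi> powi (s - r - int t)) (lin A x)"
    by (metis u(2) lin_proj lin_add lin_scale)
  have "lin A x \<in> ?M"
    using x M by blast
  then have x': "\<pi> powi (s - r - int t) * c1 (lin A x) \<in> frac_ideal (s + int d - int t)"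
    "\<pi> powi (s - r - int t) * c2 (lin A x) \<in> frac_ideal (s - int t)"
    unfolding stdW_def by (auto simp: mult_in_frac_ideal_iff simp del: coords_lin intro: frac_ideal_mono)
  have "lin A y \<in> ?L m' n'" "c3 (lin A y) = 0"
    using y L by (auto simp: y_def)
  then have y': "c1 (lin A y) \<in> frac_ideal s" "c2 (lin A y) \<in> frac_ideal s"
    unfolding L_iff by auto
  have g1: "\<pi> powi (s - int m') = c1 (lin A y) + \<pi> powi (s - r - int t) * c1 (lin A x)"
    and g2: "\<pi> powi (s - int n') = c2 (lin A y) + \<pi> powi (s - r - int t) * c2 (lin A x)"
    using arg_cong[OF gxy, of c1] arg_cong[OF gxy, of c2]
    unfolding coords_add coords_scale coords_proj g_def c1_vec c2_vec by auto
  \<comment> \<open>If m' > 0, the minimum cannot be \<open>s\<close>, so m' + d \<le> t; for m' = 0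
    nothing is claimed here.\<close>
  have "\<pi> powi (s - int m') \<in> frac_ideal (min s (s + int d - int t))"
    unfolding g1 by (rule frac_ideal_add_mono[OF y'(1) x'(1)]) auto
  moreover have "\<pi> powi (s - int n') \<in> frac_ideal (min s (s - int t))"
    unfolding g2 by (rule frac_ideal_add_mono[OF y'(2) x'(2)]) auto
  ultimately show "max n' (if m' = 0 then 0 else m' + d) \<le> max n (if m = 0 then 0 else m + d)"
    unfolding t_def[symmetric] by (auto simp: min_def split: if_splits)
qed

text \<open>Each bound is used for \<open>A\<close> and for its inverse. The order is forced: the
  bounds on \<open>r\<close> and \<open>d\<close> presuppose equal \<open>s\<close>, and those on
  \<open>m\<close> and \<open>n\<close> presuppose equal \<open>s\<close>, \<open>r\<close> and
  \<open>d\<close>.\<close>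

lemma quint_inv_eq_if_mat_act:
  assumes A: "det A \<noteq> 0" and act: "mat_act A (std_pair q) = std_pair q'"
  shows "quint_inv q = quint_inv q'"
proof -
  obtain s r d m n s' r' d' m' n' where q: "q = (s, r, d, m, n)" "q' = (s', r', d', m', n')"
    by (cases q; cases q')
  obtain B where B: "B ** A = mat 1"
    using det_nonzero_inverse[OF A] by blast
  have act': "mat_act B (std_pair q') = std_pair q"
    by (simp add: act[symmetric] mat_act_mult B)
  note acts = act[unfolded q] act'[unfolded q]
  have s: "s' = s"
    using mat_act_std_pair_le1[OF acts(1)] mat_act_std_pair_le1[OF acts(2)] by simp
  note acts = acts[unfolded s]
  have rd: "r' = r" "d' = d"
    using mat_act_std_pair_le2[OF acts(1)] mat_act_std_pair_le2[OF acts(2)] by auto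
  note acts = acts[unfolded rd]
  show ?thesis
    using mat_act_std_pair_le3[OF acts(1)] mat_act_std_pair_le3[OF acts(2)]
    unfolding q s rd quint_inv_def prod.case by (metis antisym)
qed

text \<open>Forwards, the matrices of single steps and their inverses are composed along the
  closure. Backwards, equal invariants give equal normal forms.\<close>

lemma quint_rel_iff_same_orbit:
  "(q, q') \<in> quint_rel \<longleftrightarrow> (\<exists>A. det A \<noteq> 0 \<and> mat_act A (std_pair q) = std_pair q')"
proof
  assume "(q, q') \<in> quint_rel"
  then have "equivclp quint_step q q'"
    by (simp add: quint_rel_def)
  then show "\<exists>A. det A \<noteq> 0 \<and> mat_act A (std_pair q) = std_pair q'"
  proof (induction rule: equivclp_induct)
    case base
    show ?case
      by (intro exI[of _ "mat 1"]) simp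
  next
    case (step y z)
    then obtain A where A: "det A \<noteq> 0" "mat_act A (std_pair q) = std_pair y" by blast
    have "\<exists>B. det B \<noteq> 0 \<and> mat_act B (std_pair y) = std_pair z"
      using step(2)
    proof
      assume "quint_step y z"
      then show ?thesis
        using mat_act_std_pair_step by metis
    next
      assume "quint_step z y"
      then obtain C where C: "det C \<noteq> 0" "mat_act C (std_pair z) = std_pair y"
        using mat_act_std_pair_step by metis
      then obtain B where "B ** C = mat 1" "det C * det B = 1"
        using det_nonzero_inverse by metis
      then show ?thesis
        using C(2) by (intro exI[of _ B]) (auto simp: mat_act_mult simp flip: C(2))
    qed
    then obtain B where "det B \<noteq> 0" "mat_act B (std_pair y) = std_pair z" by blast
    then show ?case
      using A by (intro exI[of _ "B ** A"]) (simp add: det_mul mat_act_mult[symmetric])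
  qed
next
  assume "\<exists>A. det A \<noteq> 0 \<and> mat_act A (std_pair q) = std_pair q'"
  then show "(q, q') \<in> quint_rel"
    using quint_inv_eq_if_mat_act[of _ q q'] equivclp_quint_step_if_inv_eq[of q q']
    by (auto simp: quint_rel_def)
qed

end

subsection \<open>Transfer to matrices and orbits\<close>

context framed_space
begin

lemma of_coords_frame3: "of_coords smul (vector [e1, e2, e3] :: 'v^3) x = vec (x$1) (x$2) (x$3)"
  by (simp add: of_coords_def vec_def sum_3)

lemma of_coords_frame2: "of_coords smul (vector [e1, e2] :: 'v^2) x = vec (x$1) (x$2) 0"
  by (simp add: of_coords_def vec_def sum_2)

lemma columns_image: "columns A = (\<lambda>i. column i A) ` UNIV"
  by (auto simp: columns_def)

text \<open>\<open>columns A\<close> is a set; passing to the indexed family permits explicit sums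
  over columns.\<close>

lemma column_lattice_eq:
  fixes e :: "'v^'n::finite" and A :: "'k^'n^'n"
  shows "column_lattice smul v e A
    = {(\<Sum>i\<in>UNIV. smul (c i) (of_coords smul e (column i A))) | c. range c \<subseteq> frac_ideal 0}"
proof -
  have "of_coords smul e ` columns A = (\<lambda>i. of_coords smul e (column i A)) ` UNIV"
    by (simp add: columns_image image_image)
  then show ?thesis
    unfolding column_lattice_def by (simp add: O_span_image)
qed

lemma column_lattice_in_lattices:
  fixes e :: "'v^'n::finite" and A :: "'k^'n^'n"
  assumes "span (column_lattice smul v e A) = U"
  shows "column_lattice smul v e A \<in> lattices smul v U"
proof -
  have "finite (of_coords smul e ` columns A)"
    by (simp add: columns_image)
  then show ?thesis
    using assms span_O_span unfolding lattices_def column_lattice_def by blast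
qed

lemma column_lattice_matV0:
  "column_lattice smul v (vector [e1, e2, e3] :: 'v^3) (matV0 \<pi> k q) = fst (std_pair0 k q)"
proof -
  obtain s r d m n where q: "q = (s, r, d, m, n)"
    by (cases q)
  let ?C = "column_lattice smul v (vector [e1, e2, e3] :: 'v^3) (matV0 \<pi> k q)"
  let ?S = "stdV (s + k) s s (\<pi> powi (k - int m)) (\<pi> powi (- int n))"
  have sum: "(\<Sum>i\<in>UNIV. smul (c i) (of_coords smul (vector [e1, e2, e3] :: 'v^3) (column i (matV0 \<pi> k q))))
    = vec (c 1 * \<pi> powi (s + k) + c 3 * \<pi> powi s * \<pi> powi (k - int m))
        (c 2 * \<pi> powi s + c 3 * \<pi> powi s * \<pi> powi (- int n)) (c 3 * \<pi> powi s)" for c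
    by (simp add: sum_3 of_coords_frame3 eq_iff_coords matV0_def q column_def map_matrix_def
      power_int_add mult.assoc)
  have "?C = ?S"
  proof
    show "?C \<subseteq> ?S"
      unfolding column_lattice_eq sum
      by (auto simp: image_subset_iff stdV_def mult.commute[of _ "\<pi> powi _"] mult_in_frac_ideal_iff)
    show "?S \<subseteq> ?C"
    proof
      fix w assume w: "w \<in> ?S"
      \<comment> \<open>Back substitution in an upper triangular system, starting from the third
        column.\<close>
      define c :: "3 \<Rightarrow> 'k" where "c = (\<lambda>i. if i = 1 then (c1 w - \<pi> powi (k - int m) * c3 w) / \<pi> powi (s + k)
        else if i = 2 then (c2 w - \<pi> powi (- int n) * c3 w) / \<pi> powi s else c3 w / \<pi> powi s)"
      have "range c \<subseteq> frac_ideal 0"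
        using w by (auto simp: c_def stdV_def div_in_frac_ideal_iff)
      moreover have "w = vec (c 1 * \<pi> powi (s + k) + c 3 * \<pi> powi s * \<pi> powi (k - int m))
        (c 2 * \<pi> powi s + c 3 * \<pi> powi s * \<pi> powi (- int n)) (c 3 * \<pi> powi s)"
        by (simp add: eq_iff_coords c_def)
      ultimately show "w \<in> ?C"
        unfolding column_lattice_eq sum by blast
    qed
  qed
  then show ?thesis
    by (simp add: q std_pair0_def)
qed

lemma column_lattice_matW0:
  "column_lattice smul v (vector [e1, e2] :: 'v^2) (matW0 \<pi> k q) = snd (std_pair0 k q)"
proof -
  obtain s r d m n where q: "q = (s, r, d, m, n)"
    by (cases q)
  let ?C = "column_lattice smul v (vector [e1, e2] :: 'v^2) (matW0 \<pi> k q)"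
  let ?S = "stdW (k + int d + r) r"
  have sum: "(\<Sum>i\<in>UNIV. smul (c i) (of_coords smul (vector [e1, e2] :: 'v^2) (column i (matW0 \<pi> k q))))
    = vec (c 1 * \<pi> powi (k + int d + r)) (c 2 * \<pi> powi r) 0" for c
    by (simp add: sum_2 of_coords_frame2 eq_iff_coords matW0_def q column_def)
  have "?C = ?S"
  proof
    show "?C \<subseteq> ?S"
      unfolding column_lattice_eq sum
      by (auto simp: image_subset_iff stdW_def mult.commute[of _ "\<pi> powi _"] mult_in_frac_ideal_iff)
    show "?S \<subseteq> ?C"
    proof
      fix w assume w: "w \<in> ?S"
      define c :: "2 \<Rightarrow> 'k" where "c = (\<lambda>i. if i = 1 then c1 w / \<pi> powi (k + int d + r)
        else c2 w / \<pi> powi r)"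
      have "range c \<subseteq> frac_ideal 0"
        using w by (auto simp: c_def stdW_def div_in_frac_ideal_iff)
      moreover have "w = vec (c 1 * \<pi> powi (k + int d + r)) (c 2 * \<pi> powi r) 0"
        using w by (simp add: eq_iff_coords c_def stdW_def)
      ultimately show "w \<in> ?C"
        unfolding column_lattice_eq sum by blast
    qed
  qed
  then show ?thesis
    by (simp add: q std_pair0_def)
qed

lemma matV_eq_matV0: "matV \<pi> q = matV0 \<pi> 0 q"
  by (simp add: matV_def matV0_def split: prod.splits)

lemma matW_eq_matW0: "matW \<pi> q = matW0 \<pi> 0 q"
  by (simp add: matW_def matW0_def vec_eq_iff forall_2 map_matrix_def power_int_add mult.commute
    split: prod.splits)

lemma span_stdV: "span (stdV a b c X Y) = UNIV"
proof -
  have "w \<in> span (stdV a b c X Y)" for w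
  proof -
    have "w = smul ((c1 w - X * c3 w) / \<pi> powi a) (vec (\<pi> powi a) 0 0)
        + smul ((c2 w - Y * c3 w) / \<pi> powi b) (vec 0 (\<pi> powi b) 0)
        + smul (c3 w / \<pi> powi c) (vec (X * \<pi> powi c) (Y * \<pi> powi c) (\<pi> powi c))"
      by (simp add: eq_iff_coords)
    also have "\<dots> \<in> span (stdV a b c X Y)"
      by (intro span_add span_scale span_base) (simp_all add: stdV_def)
    finally show ?thesis .
  qed
  then show ?thesis by blast
qed

lemma span_stdW: "span (stdW a b) = plane"
proof
  show "span (stdW a b) \<subseteq> plane"
    by (intro span_minimal) (auto simp: stdW_def plane_def subspace_def)
  show "plane \<subseteq> span (stdW a b)"
  proof
    fix w assume "w \<in> plane"
    then have "w = smul (c1 w / \<pi> powi a) (vec (\<pi> powi a) 0 0)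
        + smul (c2 w / \<pi> powi b) (vec 0 (\<pi> powi b) 0)"
      by (simp add: eq_iff_coords plane_def)
    also have "\<dots> \<in> span (stdW a b)"
      by (intro span_add span_scale span_base) (simp_all add: stdW_def)
    finally show "w \<in> span (stdW a b)" .
  qed
qed

lemma std_pair0_in_lattices: "std_pair0 k q \<in> lattices smul v UNIV \<times> lattices smul v plane"
proof -
  have "fst (std_pair0 k q) \<in> lattices smul v UNIV"
    unfolding column_lattice_matV0[symmetric]
    by (rule column_lattice_in_lattices, unfold column_lattice_matV0)
      (simp add: std_pair0_def span_stdV split: prod.splits)
  moreover have "snd (std_pair0 k q) \<in> lattices smul v plane"
    unfolding column_lattice_matW0[symmetric]
    by (rule column_lattice_in_lattices, unfold column_lattice_matW0)
      (simp add: std_pair0_def span_stdW split: prod.splits)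
  ultimately show ?thesis
    by (simp add: mem_Times_iff)
qed

lemma vec_in_plane [simp]: "vec x y z \<in> plane \<longleftrightarrow> z = 0"
  by (simp add: plane_def)

lemma frame_in_plane [simp]: "e1 \<in> plane" "e2 \<in> plane"
  by (simp_all add: plane_def)

section \<open>The groups H and H_0 as groups of matrices\<close>

lemma restrict_lin_in_GL_on:
  assumes "det A \<noteq> 0"
  shows "restrict (lin A) plane \<in> GL_on smul plane"
proof -
  have "inj (lin A)"
    using det_nonzero_inverse[OF assms] by (metis injI lin_lin lin_mat1)
  then have "bij_betw (restrict (lin A) plane) plane plane"
    using lin_image_plane[OF assms] by (simp add: bij_betw_def inj_on_def)
  then show ?thesis
    by (auto simp: GL_on_def plane_def lin_add lin_scale)
qed

lemma GL_on_cases: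
  assumes h: "h \<in> GL_on smul plane"
  obtains A where "det A \<noteq> 0" "h = restrict (lin A) plane"
proof -
  have hW: "w \<in> plane \<Longrightarrow> h w \<in> plane" for w
    using h by (auto simp: GL_on_def bij_betw_def)
  have h_add: "h (x + y) = h x + h y" if "x \<in> plane" "y \<in> plane" for x y
    using h that by (auto simp: GL_on_def)
  have h_scale: "h (smul a x) = smul a (h x)" if "x \<in> plane" for a x
    using h that by (auto simp: GL_on_def)
  have inj: "inj_on h plane"
    using h by (auto simp: GL_on_def bij_betw_def)
  define A where "A = mat2 (c1 (h e1)) (c1 (h e2)) (c2 (h e1)) (c2 (h e2))"
  have hA: "h w = lin A w" if "w \<in> plane" for w
  proof -
    have "w = smul (c1 w) e1 + smul (c2 w) e2"
      using that by (simp add: eq_iff_coords plane_def)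
    moreover have "smul a x \<in> plane" if "x \<in> plane" for a x
      using that by (simp add: plane_def)
    ultimately have "h w = h (smul (c1 w) e1) + h (smul (c2 w) e2)"
      using h_add[of "smul (c1 w) e1" "smul (c2 w) e2"] by simp
    then have "h w = smul (c1 w) (h e1) + smul (c2 w) (h e2)"
      by (simp add: h_scale)
    then show ?thesis
      using hW that by (simp add: eq_iff_coords A_def plane_def mult.commute)
  qed
  have "det A \<noteq> 0"
  proof
    assume 0: "det A = 0"
    have "w = 0" if "w \<in> plane" "lin A w = 0" for w
      using inj_onD[OF inj, of w 0] hA[of w] hA[of 0] that by (simp add: plane_def eq_iff_coords)
    note ker = this
    \<comment> \<open>These are the columns of the adjugate, which a singular \<open>A\<close>
      annihilates. Injectivity makes them zero, so \<open>A\<close> itself is zero and kills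
      \<open>e1\<close>.\<close>
    have "lin A (vec (A$2$2) (- (A$2$1)) 0) = 0" "lin A (vec (- (A$1$2)) (A$1$1) 0) = 0"
      using 0 by (simp_all add: eq_iff_coords det_2 algebra_simps)
    then have "A$2$2 = 0" "A$2$1 = 0" "A$1$1 = 0" "A$1$2 = 0"
      using ker[of "vec (A$2$2) (- (A$2$1)) 0"] ker[of "vec (- (A$1$2)) (A$1$1) 0"]
      by (simp_all add: eq_iff_coords)
    then have "lin A e1 = 0"
      by (simp add: eq_iff_coords)
    then show False
      using ker[of e1] by (simp add: eq_iff_coords)
  qed
  moreover have "h = restrict (lin A) plane"
    using h hA by (auto simp: GL_on_def extensional_def restrict_def)
  ultimately show thesis
    by (rule that)
qed

lemma GL_on_plane: "GL_on smul plane = (\<lambda>A. restrict (lin A) plane) ` {A. det A \<noteq> 0}"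
  using GL_on_cases restrict_lin_in_GL_on by (auto simp: image_iff)

lemma matrix_wrt_restrict_lin [simp]:
  "matrix_wrt smul (vector [e1, e2] :: 'v^2) (restrict (lin A) plane) = A"
  unfolding matrix_wrt_def of_coords_frame2
  by (rule the_equality)
    (auto simp: forall_2 eq_iff_coords column_def vec_eq_iff)

lemma GL0_on_plane: "GL0_on smul v plane (vector [e1, e2] :: 'v^2)
    = (\<lambda>A. restrict (lin A) plane) ` {A. det A \<noteq> 0 \<and> v (det A) = 0}"
  unfolding GL0_on_def GL_on_plane by auto

definition axis :: "'v set" where "axis = {w. c1 w = 0 \<and> c2 w = 0}"

lemma span_frame_plane: "span {e1, e2} = plane"
proof
  show "span {e1, e2} \<subseteq> plane"
    by (intro span_minimal) (auto simp: plane_def subspace_def)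
  show "plane \<subseteq> span {e1, e2}"
  proof
    fix w assume "w \<in> plane"
    then have "w = smul (c1 w) e1 + smul (c2 w) e2"
      by (simp add: eq_iff_coords plane_def)
    also have "\<dots> \<in> span {e1, e2}"
      by (intro span_add span_scale span_base) auto
    finally show "w \<in> span {e1, e2}" .
  qed
qed

lemma span_frame_axis: "span {e3} = axis"
  by (force simp: span_singleton axis_def eq_iff_coords)

text \<open>The decomposition along W and D is unique, so the definite description in
  \<open>plus_id\<close> denotes.\<close>

lemma plus_id_restrict_lin: "plus_id plane axis (restrict (lin A) plane) w = lin A w"
  unfolding plus_id_def
proof (rule the_equality)
  show "\<exists>u\<in>plane. \<exists>d\<in>axis. w = u + d \<and> lin A w = restrict (lin A) plane u + d"
    by (rule bexI[of _ "vec (c1 w) (c2 w) 0"], rule bexI[of _ "vec 0 0 (c3 w)"])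
      (simp_all add: axis_def eq_iff_coords)
  show "\<exists>u\<in>plane. \<exists>d\<in>axis. w = u + d \<and> y = restrict (lin A) plane u + d \<Longrightarrow> y = lin A w" for y
    by (auto simp: axis_def plane_def eq_iff_coords)
qed

lemma act_restrict_lin:
  assumes "p \<in> lattices smul v UNIV \<times> lattices smul v plane"
  shows "act plane axis (restrict (lin A) plane) p = mat_act A p"
proof -
  have "snd p \<subseteq> plane"
    using assms lattice_plane_subset[of "snd p"] by (simp add: mem_Times_iff)
  then have "restrict (lin A) plane ` snd p = lin A ` snd p"
    by (intro image_cong) auto
  then show ?thesis
    by (simp add: act_def mat_act_def plus_id_restrict_lin)
qed

lemma orbits_eq:
  assumes "G = (\<lambda>A. restrict (lin A) plane) ` G'" and "P = lattices smul v UNIV \<times> lattices smul v plane"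
  shows "orbits plane axis G P = (\<lambda>p. (\<lambda>A. mat_act A p) ` G') ` P"
  unfolding orbits_def assms by (intro image_cong refl) (simp add: image_image act_restrict_lin)

section \<open>Orbits and their representatives\<close>

definition orb :: "'v set \<times> 'v set \<Rightarrow> ('v set \<times> 'v set) set" where
  "orb p = (\<lambda>A. mat_act A p) ` {A. det A \<noteq> 0}"

definition orb0 :: "'v set \<times> 'v set \<Rightarrow> ('v set \<times> 'v set) set" where
  "orb0 p = (\<lambda>A. mat_act A p) ` {A. det A \<noteq> 0 \<and> v (det A) = 0}"

lemma mem_orb_self: "p \<in> orb p" and mem_orb0_self: "p \<in> orb0 p"
  unfolding orb_def orb0_def by (auto intro!: image_eqI[of _ _ "mat 1"])

lemma orb0_subset_orb: "orb0 p \<subseteq> orb p"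
  by (auto simp: orb_def orb0_def)

lemma mat_act_inverse:
  assumes "det A \<noteq> 0" "mat_act A p = p'"
  obtains B where "mat_act B p' = p" "det B \<noteq> 0" "v (det B) = - v (det A)"
proof -
  obtain B where B: "B ** A = mat 1" "det A * det B = 1"
    using det_nonzero_inverse[OF assms(1)] by metis
  have "det B \<noteq> 0" using B by auto
  moreover have "v (det B) = - v (det A)"
    using v_mult[OF assms(1) \<open>det B \<noteq> 0\<close>] B(2) by simp
  moreover have "mat_act B p' = p"
    using assms(2)[symmetric] B(1) by (simp add: mat_act_mult)
  ultimately show thesis using that by blast
qed

lemma mat_act_mem_orb: "det A \<noteq> 0 \<Longrightarrow> p' \<in> orb p \<Longrightarrow> mat_act A p' \<in> orb p"
  by (auto simp: orb_def mat_act_mult det_mul intro!: image_eqI[OF refl])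

lemma mat_act_mem_orb0:
  "det A \<noteq> 0 \<Longrightarrow> v (det A) = 0 \<Longrightarrow> p' \<in> orb0 p \<Longrightarrow> mat_act A p' \<in> orb0 p"
  by (auto simp: orb0_def mat_act_mult det_mul v_mult intro!: image_eqI[OF refl])

lemma orb_eq: "p' \<in> orb p \<Longrightarrow> orb p' = orb p"
proof -
  assume "p' \<in> orb p"
  then obtain A where A: "det A \<noteq> 0" "mat_act A p = p'"
    by (auto simp: orb_def)
  obtain B where B: "mat_act B p' = p" "det B \<noteq> 0"
    using mat_act_inverse[OF A] by metis
  have "orb p \<subseteq> orb p'" if "mat_act B p' = p" "det B \<noteq> 0" for p p' B
    using mat_act_mem_orb[OF _ mat_act_mem_orb[OF that(2) mem_orb_self[of p']]] that
    by (auto simp: orb_def[of p])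
  then show ?thesis
    using A B by blast
qed

lemma orb0_eq: "p' \<in> orb0 p \<Longrightarrow> orb0 p' = orb0 p"
proof -
  assume "p' \<in> orb0 p"
  then obtain A where A: "det A \<noteq> 0" "v (det A) = 0" "mat_act A p = p'"
    by (auto simp: orb0_def)
  obtain B where B: "mat_act B p' = p" "det B \<noteq> 0" "v (det B) = 0"
    using mat_act_inverse[OF A(1,3)] A(2) by (metis neg_0_equal_iff_equal)
  have "orb0 p \<subseteq> orb0 p'" if "mat_act B p' = p" "det B \<noteq> 0" "v (det B) = 0" for p p' B
    using mat_act_mem_orb0[OF _ _ mat_act_mem_orb0[OF that(2,3) mem_orb0_self[of p']]] that
    by (auto simp: orb0_def[of p])
  then show ?thesis
    using A B by blast
qed

lemma quint_rel_iff_orb_eq: "(q, q') \<in> quint_rel \<longleftrightarrow> orb (std_pair q) = orb (std_pair q')"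
proof -
  have "(q, q') \<in> quint_rel \<longleftrightarrow> std_pair q' \<in> orb (std_pair q)"
    unfolding quint_rel_iff_same_orbit orb_def
    by (simp add: image_iff eq_commute[of "std_pair q'"])
  then show ?thesis
    using orb_eq mem_orb_self by blast
qed

text \<open>The relation is the kernel of the map sending a quintuple to the orbit of its standard
  pair.\<close>

lemma equiv_quint_rel: "equiv UNIV quint_rel"
  by (auto simp: equiv_def refl_on_def sym_def trans_def quint_rel_iff_orb_eq)

text \<open>The determinant bound with valuation 0 applies in both directions.\<close>

lemma orb0_std_pair0_inj:
  assumes "orb0 (std_pair0 k q) = orb0 (std_pair0 j q)"
  shows "k = j"
proof -
  have "j \<le> k" if "orb0 (std_pair0 k q) = orb0 (std_pair0 j q)" for j k
  proof -
    have "std_pair0 j q \<in> orb0 (std_pair0 k q)"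
      using that mem_orb0_self by blast
    then obtain A where "det A \<noteq> 0" "v (det A) = 0" "mat_act A (std_pair0 k q) = std_pair0 j q"
      by (auto simp: orb0_def)
    then show ?thesis
      using std_pair0_det_bound by fastforce
  qed
  then show ?thesis
    using assms by (metis antisym)
qed

lemma mem_orb_std_pair_cases:
  assumes "p \<in> orb (std_pair q)"
  obtains k where "p \<in> orb0 (std_pair0 k q)"
proof -
  obtain A where A: "det A \<noteq> 0" "p = mat_act A (std_pair q)"
    using assms by (auto simp: orb_def)
  \<comment> \<open>Splitting off diag(\<pi>^k, 1) on the right of \<open>A\<close> leaves a matrix
    with unit determinant.\<close>
  define k where "k = v (det A)"
  let ?D = "mat2 (\<pi> powi k) 0 0 1"
  obtain B where B: "mat_act B (std_pair0 k q) = std_pair q" "det B \<noteq> 0" "v (det B) = - k"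
    using mat_act_inverse[of ?D, OF _ mat_act_std_pair0[of k q]] by auto
  have "p = mat_act (A ** B) (std_pair0 k q)"
    by (simp add: mat_act_mult[symmetric] A B)
  moreover have "det (A ** B) \<noteq> 0" "v (det (A ** B)) = 0"
    using A B by (simp_all add: det_mul v_mult k_def)
  ultimately show thesis
    using that[of k] by (auto simp: orb0_def)
qed

theorem orbit_classification:
  fixes Hyp defines "Hyp \<equiv> lattices smul v UNIV \<times> lattices smul v plane"
  shows "\<exists>\<Phi>. bij_betw \<Phi> (UNIV // quint_rel) (orbits plane axis (GL_on smul plane) Hyp) \<and>
    (\<forall>q. (column_lattice smul v (vector [e1, e2, e3] :: 'v^3) (matV \<pi> q),
          column_lattice smul v (vector [e1, e2] :: 'v^2) (matW \<pi> q)) \<in> \<Phi> (quint_rel `` {q})) \<and>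
    (\<forall>q. \<exists>\<Psi>. bij_betw \<Psi> (UNIV :: int set)
        {\<Omega> \<in> orbits plane axis (GL0_on smul v plane (vector [e1, e2] :: 'v^2)) Hyp.
          \<Omega> \<subseteq> \<Phi> (quint_rel `` {q})} \<and>
       (\<forall>k. (column_lattice smul v (vector [e1, e2, e3] :: 'v^3) (matV0 \<pi> k q),
             column_lattice smul v (vector [e1, e2] :: 'v^2) (matW0 \<pi> k q)) \<in> \<Psi> k))"
proof -
  have orbits: "orbits plane axis (GL_on smul plane) Hyp = orb ` Hyp"
    unfolding orbits_eq[OF GL_on_plane Hyp_def[THEN meta_eq_to_obj_eq]] orb_def ..
  have orbits0: "orbits plane axis (GL0_on smul v plane (vector [e1, e2] :: 'v^2)) Hyp = orb0 ` Hyp"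
    unfolding orbits_eq[OF GL0_on_plane Hyp_def[THEN meta_eq_to_obj_eq]] orb0_def ..
  have std0: "(column_lattice smul v (vector [e1, e2, e3] :: 'v^3) (matV0 \<pi> k q),
             column_lattice smul v (vector [e1, e2] :: 'v^2) (matW0 \<pi> k q)) = std_pair0 k q" for k q
    by (simp add: column_lattice_matV0 column_lattice_matW0)
  have std: "(column_lattice smul v (vector [e1, e2, e3] :: 'v^3) (matV \<pi> q),
          column_lattice smul v (vector [e1, e2] :: 'v^2) (matW \<pi> q)) = std_pair q" for q
    using std0[of 0 q] by (simp add: matV_eq_matV0 matW_eq_matW0 std_pair0_zero)
  \<comment> \<open>The choice within a class is harmless, since equivalent quintuples have equal
    orbits.\<close>
  define \<Phi> where "\<Phi> c = orb (std_pair (SOME q. q \<in> c))" for c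
  have \<Phi>: "\<Phi> (quint_rel `` {q}) = orb (std_pair q)" for q
  proof -
    have "(SOME q'. q' \<in> quint_rel `` {q}) \<in> quint_rel `` {q}"
      using equiv_class_self[OF equiv_quint_rel, of q] by (subst some_in_eq) blast
    then show ?thesis
      unfolding \<Phi>_def by (simp add: quint_rel_iff_orb_eq)
  qed
  have std_Hyp: "std_pair0 k q \<in> Hyp" for k q
    unfolding Hyp_def by (rule std_pair0_in_lattices)
  have "bij_betw \<Phi> (UNIV // quint_rel) (orb ` Hyp)"
    unfolding bij_betw_def
  proof
    show "inj_on \<Phi> (UNIV // quint_rel)"
    proof (rule inj_onI)
      fix c c' assume c: "c \<in> UNIV // quint_rel" "c' \<in> UNIV // quint_rel" "\<Phi> c = \<Phi> c'"
      obtain q q' where q: "c = quint_rel `` {q}" "c' = quint_rel `` {q'}"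
        using c unfolding quotient_def by auto
      then have "(q, q') \<in> quint_rel"
        using c(3) by (simp add: \<Phi> quint_rel_iff_orb_eq)
      then show "c = c'"
        unfolding q by (rule equiv_class_eq[OF equiv_quint_rel])
    qed
    have "orb p \<in> \<Phi> ` (UNIV // quint_rel)" if p: "p \<in> Hyp" for p
    proof -
      obtain A q where A: "det A \<noteq> 0" "p = mat_act A (std_pair q)"
        using mat_act_std_pair_surj[of "fst p" "snd p"] p unfolding Hyp_def
        by (metis mem_Times_iff prod.collapse)
      then have "orb p = \<Phi> (quint_rel `` {q})"
        unfolding \<Phi> by (intro orb_eq) (auto simp: orb_def)
      then show ?thesis
        by (auto intro: quotientI)
    qed
    moreover have "\<Phi> c \<in> orb ` Hyp" if "c \<in> UNIV // quint_rel" for c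
      using that std_Hyp[of 0] by (auto simp: quotient_def \<Phi> std_pair0_zero)
    ultimately show "\<Phi> ` (UNIV // quint_rel) = orb ` Hyp"
      by blast
  qed
  moreover have "bij_betw (\<lambda>k. orb0 (std_pair0 k q)) UNIV {\<Omega> \<in> orb0 ` Hyp. \<Omega> \<subseteq> orb (std_pair q)}" for q
    unfolding bij_betw_def
  proof
    show "inj (\<lambda>k. orb0 (std_pair0 k q))"
      by (rule injI) (rule orb0_std_pair0_inj)
    have "orb0 (std_pair0 k q) \<subseteq> orb (std_pair q)" for k
    proof -
      have "std_pair0 k q \<in> orb (std_pair q)"
        unfolding mat_act_std_pair0[symmetric] by (intro mat_act_mem_orb mem_orb_self) simp
      then show ?thesis
        using orb_eq orb0_subset_orb by blast
    qed
    moreover have "orb0 p \<in> range (\<lambda>k. orb0 (std_pair0 k q))" if "orb0 p \<subseteq> orb (std_pair q)" for p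
    proof -
      have "p \<in> orb (std_pair q)"
        using that mem_orb0_self by blast
      then obtain k where "p \<in> orb0 (std_pair0 k q)"
        by (rule mem_orb_std_pair_cases)
      from orb0_eq[OF this] show ?thesis
        by (rule range_eqI)
    qed
    ultimately show "range (\<lambda>k. orb0 (std_pair0 k q)) = {\<Omega> \<in> orb0 ` Hyp. \<Omega> \<subseteq> orb (std_pair q)}"
      using std_Hyp by blast
  qed
  ultimately show ?thesis
    unfolding orbits orbits0 std std0
  proof (intro exI[of _ \<Phi>] conjI allI)
    show "std_pair q \<in> \<Phi> (quint_rel `` {q})" for q
      unfolding \<Phi> by (rule mem_orb_self)
    show "\<exists>\<Psi>. bij_betw \<Psi> (UNIV :: int set) {\<Omega> \<in> orb0 ` Hyp. \<Omega> \<subseteq> \<Phi> (quint_rel `` {q})}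
        \<and> (\<forall>k. std_pair0 k q \<in> \<Psi> k)" if "\<And>q. bij_betw (\<lambda>k. orb0 (std_pair0 k q)) UNIV
          {\<Omega> \<in> orb0 ` Hyp. \<Omega> \<subseteq> orb (std_pair q)}" for q
      unfolding \<Phi> using that mem_orb0_self by blast
  qed
qed

end

section \<open>From the subspaces W and D to an adapted frame\<close>

theorem theorem1:
  fixes smul :: "'k::field_char_0 \<Rightarrow> 'v::ab_group_add \<Rightarrow> 'v"
    and v :: "'k \<Rightarrow> int" and F :: "'k set" and \<pi> :: 'k
    and W D L\<^sub>W L\<^sub>D :: "'v set" and e\<^sub>1 e\<^sub>2 e\<^sub>3 :: 'v
  assumes "totally_real_number_field F" and "completion_at_finite_place v F"
    and "uniformizer v \<pi>"
    and "vector_space smul" and "vector_space.dim smul (UNIV :: 'v set) = 3"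
    and "module.subspace smul W" and "vector_space.dim smul W = 2"
    and "module.subspace smul D" and "vector_space.dim smul D = 1" and "\<not> D \<subseteq> W"
    and "L\<^sub>W \<in> lattices smul v W" and "O_basis smul v L\<^sub>W (vector [e\<^sub>1, e\<^sub>2] :: 'v^2)"
    and "L\<^sub>D \<in> lattices smul v D" and "O_basis smul v L\<^sub>D (vector [e\<^sub>3] :: 'v^1)"
  defines "eV \<equiv> (vector [e\<^sub>1, e\<^sub>2, e\<^sub>3] :: 'v^3)" and "eW \<equiv> (vector [e\<^sub>1, e\<^sub>2] :: 'v^2)"
    and "Hyp \<equiv> lattices smul v (UNIV :: 'v set) \<times> lattices smul v W"
    and "H \<equiv> GL_on smul W" and "H\<^sub>0 \<equiv> GL0_on smul v W (vector [e\<^sub>1, e\<^sub>2] :: 'v^2)"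
  shows "\<exists>\<Phi>. bij_betw \<Phi> (UNIV // quint_rel) (orbits W D H Hyp) \<and>
    (\<forall>q. (column_lattice smul v eV (matV \<pi> q), column_lattice smul v eW (matW \<pi> q))
           \<in> \<Phi> (quint_rel `` {q})) \<and>
    (\<forall>q. \<exists>\<Psi>. bij_betw \<Psi> (UNIV :: int set) {\<Omega> \<in> orbits W D H\<^sub>0 Hyp. \<Omega> \<subseteq> \<Phi> (quint_rel `` {q})} \<and>
       (\<forall>k. (column_lattice smul v eV (matV0 \<pi> k q), column_lattice smul v eW (matW0 \<pi> k q))
              \<in> \<Psi> k))"
proof -
  interpret vs: vector_space smul by fact
  have "normalized_valuation v"
    using assms(2) by (simp add: completion_at_finite_place_def)
  then interpret valued_vector_space smul v \<pi>
    using assms(3) by unfold_locales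
  \<comment> \<open>\<open>O_span\<close> has the same span over the field as its generators, so any
    two finite generating sets of \<open>L\<^sub>W\<close> span the same subspace.\<close>
  have W: "W = vs.span {e\<^sub>1, e\<^sub>2}"
  proof -
    have "range (\<lambda>i. (vector [e\<^sub>1, e\<^sub>2] :: 'v^2) $ i) = {e\<^sub>1, e\<^sub>2}"
      by (simp add: UNIV_2)
    then have LW: "L\<^sub>W = O_span smul v {e\<^sub>1, e\<^sub>2}"
      using assms(12) by (simp add: O_basis_def)
    obtain B where "finite B" "L\<^sub>W = O_span smul v B" "vs.span B = W"
      using assms(11) unfolding lattices_def by blast
    then show ?thesis
      using LW span_O_span[of B] span_O_span[of "{e\<^sub>1, e\<^sub>2}"] by simp
  qed
  have D: "D = vs.span {e\<^sub>3}"
  proof -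
    have "range (\<lambda>i. (vector [e\<^sub>3] :: 'v^1) $ i) = {e\<^sub>3}"
      by (simp add: UNIV_1)
    then have LD: "L\<^sub>D = O_span smul v {e\<^sub>3}"
      using assms(14) by (simp add: O_basis_def)
    obtain B where "finite B" "L\<^sub>D = O_span smul v B" "vs.span B = D"
      using assms(13) unfolding lattices_def by blast
    then show ?thesis
      using LD span_O_span[of B] span_O_span[of "{e\<^sub>3}"] by simp
  qed
  have W_not_line: "W \<noteq> vs.span {e}" for e
    using vs.dim_le_card[of W "{e}"] assms(7) by auto
  have e3: "e\<^sub>3 \<notin> vs.span {e\<^sub>1, e\<^sub>2}"
  proof
    assume "e\<^sub>3 \<in> vs.span {e\<^sub>1, e\<^sub>2}"
    then have "vs.span {e\<^sub>3} \<subseteq> vs.span {e\<^sub>1, e\<^sub>2}"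
      by (intro vs.span_minimal) auto
    then show False
      using assms(10) W D by simp
  qed
  have e2: "e\<^sub>2 \<notin> vs.span {e\<^sub>1}"
    using W_not_line[of "e\<^sub>1"] vs.span_redundant[of "e\<^sub>2" "{e\<^sub>1}"] W by (auto simp: insert_commute)
  have e1: "e\<^sub>1 \<noteq> 0"
    using W_not_line[of "e\<^sub>2"] W by auto
  have ind: "vs.independent {e\<^sub>3, e\<^sub>2, e\<^sub>1}"
    using e1 e2 e3 by (intro vs.independent_insertI vs.independent_empty) (auto simp: insert_commute)
  have card: "card {e\<^sub>3, e\<^sub>2, e\<^sub>1} = 3"
    using e2 e3 vs.span_base[of _ "{e\<^sub>1, e\<^sub>2}"] vs.span_base[of "e\<^sub>1" "{e\<^sub>1}"]
    by (auto simp: card_insert_if)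
  \<comment> \<open>Since \<open>card\<close> is 0 on infinite sets, dimension 3 also yields
    finiteness.\<close>
  obtain B where B: "finite B" "card B = 3" "vs.span B = UNIV"
    using assms(5) vs.basis_exists[of UNIV] by (metis card.infinite top.extremum_unique zero_neq_numeral)
  have spanning: "w \<in> vs.span {e\<^sub>3, e\<^sub>2, e\<^sub>1}" for w
  proof (rule ccontr)
    assume w: "w \<notin> vs.span {e\<^sub>3, e\<^sub>2, e\<^sub>1}"
    then have "card {w, e\<^sub>3, e\<^sub>2, e\<^sub>1} = Suc (card {e\<^sub>3, e\<^sub>2, e\<^sub>1})"
      using vs.span_base[of w "{e\<^sub>3, e\<^sub>2, e\<^sub>1}"] by (intro card_insert_disjoint) auto
    moreover have "card {w, e\<^sub>3, e\<^sub>2, e\<^sub>1} \<le> 3"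
      using vs.independent_span_bound[of B "{w, e\<^sub>3, e\<^sub>2, e\<^sub>1}"] vs.independent_insertI[OF w ind] B
      by simp
    ultimately show False
      using card by simp
  qed
  interpret framed_space smul v \<pi> e\<^sub>1 e\<^sub>2 e\<^sub>3
  proof
    fix x y z assume 0: "smul x e\<^sub>1 + smul y e\<^sub>2 + smul z e\<^sub>3 = 0"
    \<comment> \<open>The coefficients vanish from the last to the first: \<open>e\<^sub>3\<close>
      lies outside W, \<open>e\<^sub>2\<close> outside the line of \<open>e\<^sub>1\<close>, and
      \<open>e\<^sub>1\<close> is nonzero.\<close>
    have z: "z = 0"
    proof (rule ccontr)
      assume "z \<noteq> 0"
      have "smul z e\<^sub>3 = - (smul x e\<^sub>1 + smul y e\<^sub>2)"
        using 0 by (simp only: add_eq_0_iff)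
      also have "\<dots> \<in> vs.span {e\<^sub>1, e\<^sub>2}"
        by (intro vs.span_neg vs.span_add vs.span_scale vs.span_base) auto
      finally show False
        using e3 \<open>z \<noteq> 0\<close> vs.span_scale[of "smul z e\<^sub>3" _ "inverse z"] by simp
    qed
    have y: "y = 0"
    proof (rule ccontr)
      assume "y \<noteq> 0"
      have "smul y e\<^sub>2 = - smul x e\<^sub>1"
        using 0 z by (simp add: add_eq_0_iff)
      also have "\<dots> \<in> vs.span {e\<^sub>1}"
        by (intro vs.span_neg vs.span_scale vs.span_base) auto
      finally show False
        using e2 \<open>y \<noteq> 0\<close> vs.span_scale[of "smul y e\<^sub>2" _ "inverse y"] by simp
    qed
    show "x = 0 \<and> y = 0 \<and> z = 0"
      using 0 y z e1 by simp
  next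
    fix w
    have "w \<in> vs.span {e\<^sub>3, e\<^sub>2, e\<^sub>1}"
      by (rule spanning)
    then obtain z y x where "w - smul z e\<^sub>3 - smul y e\<^sub>2 - smul x e\<^sub>1 = 0"
      by (auto simp: vs.span_insert)
    then have "w = smul x e\<^sub>1 + smul y e\<^sub>2 + smul z e\<^sub>3"
      by (simp add: algebra_simps)
    then show "\<exists>x y z. w = smul x e\<^sub>1 + smul y e\<^sub>2 + smul z e\<^sub>3"
      by blast
  qed
  have "W = plane"
    unfolding W by (rule span_frame_plane)
  moreover have "D = axis"
    unfolding D by (rule span_frame_axis)
  ultimately show ?thesis
    using orbit_classification unfolding assms(15-) by simp
qed

end
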